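(* Let $f\in\mathcal T_n$ be a type function and let $M$ be the number of maximal chains of its reduced structure poset $\mathcal P_f^0$. Then there is a normal form of $f$ (an expression of $f$ as a finite combination, by the lattice operations $\vee$ and $\wedge$, of chain types in $\mathcal T_{n,O_f}$) such that the number of different chain types involved is less than or equal to $M$.
   Context: Notation. $[n]=\{1,\dots,n\}$; $\theta=\theta_n\in\{0,1\}^n$ is the zero string. $\mathcal F_n=\{f:\{0,1\}^n\to\{0,1\} : f(\theta)=1\}$ is a Boolean algebra for the pointwise order, with $\vee,\wedge$ the pointwise maximum/minimum; $p_n$ is the indicator function of $\{\theta\}$, $1_n$ the constant function $1$, and $f^*=1-f+p_n$. For $T\subseteq[n]$, $p_T(s)=\prod_{i\in T}(1-s_i)$. For $f\in\mathcal F_m$, $g\in\mathcal F_n$, $(f\otimes g)(s^1s^2)=f(s^1)g(s^2)$, where $s^1\in\{0,1\}^m$, $s^2\in\{0,1\}^n$ and $s^1s^2$ is the concatenation. A permutation $\sigma$ of $[n]$ acts on strings by $\sigma(s)=s_{\sigma^{-1}(1)}\dots s_{\sigma^{-1}(n)}$. With $e^i_j=\delta_{i,j}$, put $I_f=\{i: f(e^i)=0\}$, $O_f=\{j: f(e^j)=1\}$. Type functions. The sets $\mathcal T_n\subseteq\mathcal F_n$ ($n\ge1$) of type functions form the smallest family with $1_1\in\mathcal T_1$ closed under $f\mapsto f^*$, $f\mapsto f\circ\sigma$ (all permutations), and $(f,g)\mapsto f\otimes g$. $\mathcal T_{n,O}=\{f\in\mathcal T_n:O_f=O\}$. A type function $f\in\mathcal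 T_n$ is a chain type if there are sets $S_0\subsetneq\dots\subsetneq S_N\subseteq[n]$ with $N$ even such that $f=\sum_{i=0}^N(-1)^ip_{S_i}$. Structure posets. Every $f\in\mathcal F_n$ has a unique expansion $f=\sum_{T\subseteq[n]}\hat f_T\,p_T$ with real coefficients. For $f\in\mathcal T_n$, $\mathcal P_f=\{T\subseteq[n]:\hat f_T\ne0\}$ ordered by inclusion; for $T\in\mathcal P_f$, $L_T=T\setminus\bigcup\{S\in\mathcal P_f:S\subsetneq T\}$. The reduced structure poset $\mathcal P_f^0\subseteq\mathcal P_f$ (with the inherited order) consists of $\emptyset$ (if $\emptyset\in\mathcal P_f$) and all $T\in\mathcal P_f$ with $L_T\neq\emptyset$. A maximal chain is a totally ordered subset that is maximal under inclusion among such subsets. *)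

theory Defs
  imports "HOL-Library.FuncSet" "HOL-Combinatorics.Permutations" Complex_Main
begin

text \<open>Strings in $\{0,1\}^n$ are extensional functions on \<open>{1..n}\<close>, and Boolean functions are
  extensional functions on those strings.  Both take values in \<open>{0, 1} :: real set\<close>, so that the
  arithmetic formulas below apply literally.\<close>

type_synonym string01 = "nat \<Rightarrow> real"
type_synonym boolfun = "string01 \<Rightarrow> real"

definition strings :: "nat \<Rightarrow> string01 set" where
  "strings n = {1..n} \<rightarrow>\<^sub>E {0, 1}"

definition zero_string :: "nat \<Rightarrow> string01" where
  "zero_string n = (\<lambda>i\<in>{1..n}. 0)"

definition unit_string :: "nat \<Rightarrow> nat \<Rightarrow> string01" where
  "unit_string n i = (\<lambda>j\<in>{1..n}. if i = j then 1 else 0)"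

definition bool_functions :: "nat \<Rightarrow> boolfun set" where
  "bool_functions n = {f \<in> strings n \<rightarrow>\<^sub>E {0, 1}. f (zero_string n) = 1}"

definition outputs :: "nat \<Rightarrow> boolfun \<Rightarrow> nat set" where
  "outputs n f = {j \<in> {1..n}. f (unit_string n j) = 1}"

definition compl_fun :: "nat \<Rightarrow> boolfun \<Rightarrow> boolfun" where
  "compl_fun n f = (\<lambda>s\<in>strings n. 1 - f s + of_bool (s = zero_string n))"

definition perm_string :: "nat \<Rightarrow> (nat \<Rightarrow> nat) \<Rightarrow> string01 \<Rightarrow> string01" where
  "perm_string n \<sigma> s = (\<lambda>i\<in>{1..n}. s (inv \<sigma> i))"

definition perm_fun :: "nat \<Rightarrow> boolfun \<Rightarrow> (nat \<Rightarrow> nat) \<Rightarrow> boolfun" where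
  "perm_fun n f \<sigma> = (\<lambda>s\<in>strings n. f (perm_string n \<sigma> s))"

text \<open>A string of length \<open>m + n\<close> is split into its first \<open>m\<close> and its last \<open>n\<close> entries.\<close>

definition tensor_fun :: "nat \<Rightarrow> nat \<Rightarrow> boolfun \<Rightarrow> boolfun \<Rightarrow> boolfun" where
  "tensor_fun m n f g =
     (\<lambda>s\<in>strings (m + n). f (\<lambda>i\<in>{1..m}. s i) * g (\<lambda>i\<in>{1..n}. s (m + i)))"

definition p_fun :: "nat \<Rightarrow> nat set \<Rightarrow> boolfun" where
  "p_fun n T = (\<lambda>s\<in>strings n. \<Prod>i\<in>T. 1 - s i)"

inductive is_type :: "nat \<Rightarrow> boolfun \<Rightarrow> bool" where
  one: "is_type 1 (\<lambda>s\<in>strings 1. 1)"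
| compl: "is_type n f \<Longrightarrow> is_type n (compl_fun n f)"
| perm: "is_type n f \<Longrightarrow> \<sigma> permutes {1..n} \<Longrightarrow> is_type n (perm_fun n f \<sigma>)"
| tensor: "is_type m f \<Longrightarrow> is_type n g \<Longrightarrow> is_type (m + n) (tensor_fun m n f g)"

definition type_functions :: "nat \<Rightarrow> boolfun set" where
  "type_functions n = {f. is_type n f}"

definition type_functions_out :: "nat \<Rightarrow> nat set \<Rightarrow> boolfun set" where
  "type_functions_out n O' = {f \<in> type_functions n. outputs n f = O'}"

definition chain_type :: "nat \<Rightarrow> boolfun \<Rightarrow> bool" where
  "chain_type n f \<longleftrightarrow> f \<in> type_functions n \<and>
     (\<exists>N S. even N \<and> (\<forall>i<N. S i \<subset> S (Suc i)) \<and> S N \<subseteq> {1..n} \<and>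
        f = (\<lambda>s\<in>strings n. \<Sum>i\<le>N. (-1) ^ i * p_fun n (S i) s))"

definition p_expansion :: "nat \<Rightarrow> boolfun \<Rightarrow> (nat set \<Rightarrow> real) \<Rightarrow> bool" where
  "p_expansion n f c \<longleftrightarrow> c \<in> extensional (Pow {1..n}) \<and>
     f = (\<lambda>s\<in>strings n. \<Sum>T\<in>Pow {1..n}. c T * p_fun n T s)"

definition coefs :: "nat \<Rightarrow> boolfun \<Rightarrow> nat set \<Rightarrow> real" where
  "coefs n f = (THE c. p_expansion n f c)"

definition structure_poset :: "nat \<Rightarrow> boolfun \<Rightarrow> nat set set" where
  "structure_poset n f = {T \<in> Pow {1..n}. coefs n f T \<noteq> 0}"

definition new_labels :: "nat \<Rightarrow> boolfun \<Rightarrow> nat set \<Rightarrow> nat set" where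
  "new_labels n f T = T - \<Union> {S \<in> structure_poset n f. S \<subset> T}"

definition reduced_poset :: "nat \<Rightarrow> boolfun \<Rightarrow> nat set set" where
  "reduced_poset n f = {T \<in> structure_poset n f. T = {} \<or> new_labels n f T \<noteq> {}}"

datatype (leaves: 'a) lattice_expr =
    Leaf 'a
  | Join "'a lattice_expr" "'a lattice_expr"
  | Meet "'a lattice_expr" "'a lattice_expr"

text \<open>On \<open>boolfun\<close>, \<open>sup\<close> and \<open>inf\<close> are the pointwise maximum and minimum; they preserve
  extensionality because \<open>sup undefined undefined = undefined\<close>.\<close>

primrec eval_expr :: "'a::lattice lattice_expr \<Rightarrow> 'a" where
  "eval_expr (Leaf x) = x"
| "eval_expr (Join a b) = sup (eval_expr a) (eval_expr b)"
| "eval_expr (Meet a b) = inf (eval_expr a) (eval_expr b)"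

definition normal_form :: "nat \<Rightarrow> boolfun \<Rightarrow> boolfun lattice_expr \<Rightarrow> bool" where
  "normal_form n f e \<longleftrightarrow> eval_expr e = f \<and>
     (\<forall>g\<in>leaves e. chain_type n g \<and> g \<in> type_functions_out n (outputs n f))"


text \<open>Existence and uniqueness of the expansion, so that the definite description in
  \<open>coefs\<close> is meaningful.\<close>

lemma strings_indicator_image:
  "strings n = (\<lambda>T. \<lambda>i\<in>{1..n}. of_bool (i \<notin> T)) ` Pow {1..n}"
proof (intro subset_antisym subsetI)
  fix s assume s: "s \<in> strings n"
  have "s = (\<lambda>i\<in>{1..n}. of_bool (i \<notin> {i \<in> {1..n}. s i = 0}))"
  proof (rule extensionalityI[of _ "{1..n}"])
    show "s \<in> extensional {1..n}" using s by (simp add: strings_def PiE_def)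
    show "(\<lambda>i\<in>{1..n}. of_bool (i \<notin> {i \<in> {1..n}. s i = 0})) \<in> extensional {1..n}" by simp
    fix i assume "i \<in> {1..n}"
    moreover have "s i \<in> {0, 1}" if "i \<in> {1..n}" using s that unfolding strings_def by (rule PiE_mem)
    ultimately show "s i = (\<lambda>i\<in>{1..n}. of_bool (i \<notin> {i \<in> {1..n}. s i = 0})) i" by auto
  qed
  then show "s \<in> (\<lambda>T. \<lambda>i\<in>{1..n}. of_bool (i \<notin> T)) ` Pow {1..n}" by blast
qed (auto simp: strings_def)

lemma p_fun_indicator:
  assumes "S \<subseteq> {1..n}"
  shows "p_fun n S (\<lambda>i\<in>{1..n}. of_bool (i \<notin> T)) = of_bool (S \<subseteq> T)"
proof -
  have fin: "finite S" using assms finite_subset by blast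
  have mem: "(\<lambda>i\<in>{1..n}. of_bool (i \<notin> T)) \<in> strings n" by (auto simp: strings_def)
  have "(\<Prod>i\<in>S. 1 - (\<lambda>i\<in>{1..n}. of_bool (i \<notin> T)) i) = (\<Prod>i\<in>S. of_bool (i \<in> T) :: real)"
    using assms by (intro prod.cong) auto
  also have "\<dots> = of_bool (S \<subseteq> T)"
    using fin by (cases "S \<subseteq> T") (auto intro!: prod.neutral prod_zero)
  finally show ?thesis using mem by (simp add: p_fun_def)
qed

lemma p_expansion_iff:
  assumes "f \<in> extensional (strings n)"
  shows "p_expansion n f c \<longleftrightarrow> c \<in> extensional (Pow {1..n}) \<and>
           (\<forall>T\<subseteq>{1..n}. f (\<lambda>i\<in>{1..n}. of_bool (i \<notin> T)) = (\<Sum>S\<in>Pow T. c S))"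
proof -
  let ?\<chi> = "\<lambda>T. \<lambda>i\<in>{1..n}. of_bool (i \<notin> T) :: real"
  have "f = (\<lambda>s\<in>strings n. \<Sum>T\<in>Pow {1..n}. c T * p_fun n T s) \<longleftrightarrow>
        (\<forall>s\<in>strings n. f s = (\<Sum>T\<in>Pow {1..n}. c T * p_fun n T s))"
  proof
    assume eq: "\<forall>s\<in>strings n. f s = (\<Sum>T\<in>Pow {1..n}. c T * p_fun n T s)"
    show "f = (\<lambda>s\<in>strings n. \<Sum>T\<in>Pow {1..n}. c T * p_fun n T s)"
      using eq by (intro extensionalityI[OF assms]) simp_all
  next
    assume eq: "f = (\<lambda>s\<in>strings n. \<Sum>T\<in>Pow {1..n}. c T * p_fun n T s)"
    show "\<forall>s\<in>strings n. f s = (\<Sum>T\<in>Pow {1..n}. c T * p_fun n T s)"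
      by (subst eq) simp
  qed
  also have "\<dots> \<longleftrightarrow> (\<forall>T\<in>Pow {1..n}. f (?\<chi> T) = (\<Sum>S\<in>Pow {1..n}. c S * p_fun n S (?\<chi> T)))"
    unfolding strings_indicator_image by (simp only: ball_simps)
  also have "\<dots> \<longleftrightarrow> (\<forall>T\<in>Pow {1..n}. f (?\<chi> T) = (\<Sum>S\<in>Pow T. c S))"
  proof (intro ball_cong refl arg_cong2[where f = "(=)"])
    fix T assume T: "T \<in> Pow {1..n}"
    have "(\<Sum>S\<in>Pow {1..n}. c S * p_fun n S (?\<chi> T)) = (\<Sum>S\<in>Pow {1..n}. if S \<in> Pow T then c S else 0)"
    proof (rule sum.cong)
      fix S assume "S \<in> Pow {1..n}"
      then have "p_fun n S (?\<chi> T) = of_bool (S \<subseteq> T)" by (intro p_fun_indicator) simp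
      then show "c S * p_fun n S (?\<chi> T) = (if S \<in> Pow T then c S else 0)" by simp
    qed simp
    also have "\<dots> = (\<Sum>S\<in>Pow {1..n} \<inter> Pow T. c S)"
      by (rule sum.inter_restrict[symmetric]) simp
    also have "Pow {1..n} \<inter> Pow T = Pow T" using T by auto
    finally show "(\<Sum>S\<in>Pow {1..n}. c S * p_fun n S (?\<chi> T)) = (\<Sum>S\<in>Pow T. c S)" .
  qed
  finally show ?thesis by (auto simp: p_expansion_def)
qed

lemma ex1_p_expansion:
  assumes f: "f \<in> extensional (strings n)"
  shows "\<exists>!c. p_expansion n f c"
proof (rule ex_ex1I)
  let ?F = "\<lambda>T. f (\<lambda>i\<in>{1..n}. of_bool (i \<notin> T))"
  let ?g = "\<lambda>T. \<Sum>S\<in>Pow T. (-1) ^ card S * ?F S"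
  let ?c = "\<lambda>T\<in>Pow {1..n}. (-1) ^ card T * ?g T"
  have "?F T = (\<Sum>S\<in>Pow T. ?c S)" if T: "T \<subseteq> {1..n}" for T
  proof -
    have "?F T = (\<Sum>S\<in>Pow T. (-1) ^ card S * ?g S)"
      by (rule inclusion_exclusion_symmetric[where f = ?F and g = ?g])
        (rule refl, rule finite_subset[OF T finite_atLeastAtMost])
    also have "\<dots> = (\<Sum>S\<in>Pow T. ?c S)"
      using T by (intro sum.cong) auto
    finally show ?thesis .
  qed
  then show "\<exists>c. p_expansion n f c"
    using f by (intro exI[of _ ?c]) (simp add: p_expansion_iff)
next
  fix c d assume "p_expansion n f c" "p_expansion n f d"
  then have ext: "c \<in> extensional (Pow {1..n})" "d \<in> extensional (Pow {1..n})"
    and eq: "\<And>T. T \<subseteq> {1..n} \<Longrightarrow> (\<Sum>S\<in>Pow T. c S) = (\<Sum>S\<in>Pow T. d S)"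
    using f by (auto simp: p_expansion_iff)
  have "c T = d T" if "T \<subseteq> {1..n}" for T
    using finite_subset[OF that finite_atLeastAtMost] that
  proof (induction T rule: finite_psubset_induct)
    case (psubset T)
    have split: "(\<Sum>S\<in>Pow T. h S) = h T + (\<Sum>S\<in>Pow T - {T}. h S)" for h :: "nat set \<Rightarrow> real"
      using psubset.hyps by (intro sum.remove) auto
    have "(\<Sum>S\<in>Pow T - {T}. c S) = (\<Sum>S\<in>Pow T - {T}. d S)"
      using psubset by (intro sum.cong) auto
    with eq[OF psubset.prems] show ?case by (simp add: split)
  qed
  with ext show "c = d" by (intro extensionalityI) auto
qed

lemma p_expansion_coefs:
  "f \<in> extensional (strings n) \<Longrightarrow> p_expansion n f (coefs n f)"
  unfolding coefs_def by (rule theI'[OF ex1_p_expansion])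

lemma zero_string_in_strings: "zero_string n \<in> strings n"
  by (simp add: zero_string_def strings_def)

lemma strings_mem: "s \<in> strings n \<Longrightarrow> i \<in> {1..n} \<Longrightarrow> s i \<in> {0, 1}"
  unfolding strings_def by (rule PiE_mem)

lemma bool_functions_iff:
  "f \<in> bool_functions n \<longleftrightarrow>
     f \<in> extensional (strings n) \<and> (\<forall>s\<in>strings n. f s \<in> {0, 1}) \<and> f (zero_string n) = 1"
  unfolding bool_functions_def PiE_def Pi_def by blast

lemma restrict_in_strings: "(\<And>i. i \<in> {1..n} \<Longrightarrow> s i \<in> {0, 1}) \<Longrightarrow> restrict s {1..n} \<in> strings n"
  unfolding strings_def by (rule restrict_PiE_iff[THEN iffD2]) blast

lemma type_functions_subset: "type_functions n \<subseteq> bool_functions n"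
proof
  fix f assume "f \<in> type_functions n"
  then have "is_type n f" by (simp add: type_functions_def)
  then show "f \<in> bool_functions n"
  proof induction
    case one
    show ?case
      unfolding bool_functions_iff by (intro conjI ballI restrict_extensional)
        (simp_all only: restrict_apply' zero_string_in_strings insert_iff simp_thms)
  next
    case (compl n f)
    then have f: "f s \<in> {0, 1}" if "s \<in> strings n" for s using that by (simp add: bool_functions_iff)
    have "compl_fun n f s \<in> {0, 1}" if "s \<in> strings n" for s
      using f[OF that] compl.IH that by (auto simp: compl_fun_def bool_functions_iff)
    moreover have "compl_fun n f \<in> extensional (strings n)"
      unfolding compl_fun_def by (rule restrict_extensional)
    moreover have "compl_fun n f (zero_string n) = 1"
      using compl.IH zero_string_in_strings[of n] by (simp add: bool_functions_iff compl_fun_def)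
    ultimately show ?case unfolding bool_functions_iff by blast
  next
    case (perm n f \<sigma>)
    have inv: "inv \<sigma> i \<in> {1..n}" if "i \<in> {1..n}" for i
      using permutes_in_image[OF permutes_inv[OF perm.hyps(2)], of i] that by blast
    have mem: "perm_string n \<sigma> s \<in> strings n" if "s \<in> strings n" for s
      unfolding perm_string_def by (intro restrict_in_strings strings_mem[OF that] inv)
    have "perm_string n \<sigma> (zero_string n) = zero_string n"
      unfolding perm_string_def zero_string_def by (intro restrict_ext restrict_apply' inv)
    then have "perm_fun n f \<sigma> (zero_string n) = 1"
      using perm.IH zero_string_in_strings[of n] by (simp add: bool_functions_iff perm_fun_def)
    moreover have "perm_fun n f \<sigma> s \<in> {0, 1}" if "s \<in> strings n" for s
      using perm.IH mem[OF that] unfolding bool_functions_iff perm_fun_def restrict_apply'[OF that]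
      by blast
    moreover have "perm_fun n f \<sigma> \<in> extensional (strings n)"
      unfolding perm_fun_def by (rule restrict_extensional)
    ultimately show ?case unfolding bool_functions_iff by blast
  next
    case (tensor m f n g)
    let ?l = "\<lambda>s. \<lambda>i\<in>{1..m}. s i" and ?r = "\<lambda>s. \<lambda>i\<in>{1..n}. s (m + i)"
    have l: "?l s \<in> strings m" and r: "?r s \<in> strings n" if "s \<in> strings (m + n)" for s
      by (intro restrict_in_strings strings_mem[OF that]; simp)+
    have "tensor_fun m n f g s \<in> {0, 1}" if "s \<in> strings (m + n)" for s
    proof -
      have "f (?l s) \<in> {0, 1}" "g (?r s) \<in> {0, 1}"
        using tensor.IH l[OF that] r[OF that] unfolding bool_functions_iff by blast+
      then show ?thesis unfolding tensor_fun_def restrict_apply'[OF that] by auto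
    qed
    moreover have "?l (zero_string (m + n)) = zero_string m"
      unfolding zero_string_def by (intro restrict_ext) simp
    moreover have "?r (zero_string (m + n)) = zero_string n"
      unfolding zero_string_def by (intro restrict_ext) simp
    moreover have "tensor_fun m n f g \<in> extensional (strings (m + n))"
      unfolding tensor_fun_def by (rule restrict_extensional)
    moreover have "tensor_fun m n f g (zero_string (m + n)) =
        f (?l (zero_string (m + n))) * g (?r (zero_string (m + n)))"
      unfolding tensor_fun_def by (rule restrict_apply'[OF zero_string_in_strings])
    ultimately show ?case
      using tensor.IH unfolding bool_functions_iff by simp
  qed
qed

end

theory Submission
  imports Defs
begin

text \<open>A function $f = \sum_S c_S p_S$ takes the value $\sum_{S \subseteq T} c_S$ at the string whose
  set of zeros is $T$, so type functions can be studied through their coefficients alone, on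
  arbitrary finite sets of labels.  By induction, $k(f) \le M(f)$, where $k(f)$ is the least number
  of chain types in a normal form and $M(f)$ the number of maximal chains of the reduced poset.

  Passing to $f^*$ only adds or removes the elements $\emptyset$ and $[n]$, which are comparable to
  everything, so $M(f^*) = M(f)$; and $k(f^*) = k(f)$ by duality.  For a tensor product, let
  $f \lhd g$ be $f(s^1)$ on strings $s^1s^2$ with $s^1 \ne \theta$ and $g(s^2)$ otherwise.  The bounds
  $f \le p_{O_f}^*$ and $g \le p_{O_g}^*$ give
  $f \otimes g = (f \lhd p_{O_g}^*) \wedge (g \lhd p_{O_f}^*)$; since $\lhd$ distributes over the
  lattice operations and $h \lhd p_P^*$ is a chain type if $h$ is, $k(f \otimes g) \le k(f) + k(g)$.
  On the other side, the reduced poset of $f \otimes g$ consists of the pairs with one component in a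
  reduced poset and the other one minimal.  A maximal chain of $\mathcal P_f^0$ with at least two
  elements, paired with a fixed minimal element of $\mathcal P_g$, is therefore maximal, whence
  $M(f \otimes g) \ge M(f) + M(g)$ unless there are maximal chains with a single element; these occur
  only if $f$ or $g$ is some $p_T$, and tensoring with $p_T$ preserves chain types and does not
  decrease $M$.\<close>

subsection \<open>Coefficients of type functions\<close>

definition zeta :: "('a set \<Rightarrow> real) \<Rightarrow> 'a set \<Rightarrow> real" where
  "zeta c T = (\<Sum>S\<in>Pow T. c S)"

text \<open>This is the coefficient function of p_S; in particular \<open>single {}\<close> is the
  constant 1 and \<open>single A\<close> the indicator of the zero string.\<close>

definition single :: "'a set \<Rightarrow> 'a set \<Rightarrow> real" where
  "single S = (\<lambda>T. of_bool (T = S))"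

definition star_coef :: "'a set \<Rightarrow> ('a set \<Rightarrow> real) \<Rightarrow> 'a set \<Rightarrow> real" where
  "star_coef A c = (\<lambda>S. single {} S + single A S - c S)"

text \<open>The tensor product of p_S and p_S' is p of their union, so coefficients multiply.
  Coefficient functions are total; the guard keeps the support inside
  \<open>Pow (A \<union> B)\<close>.\<close>

definition tensor_coef ::
  "'a set \<Rightarrow> 'a set \<Rightarrow> ('a set \<Rightarrow> real) \<Rightarrow> ('a set \<Rightarrow> real) \<Rightarrow> 'a set \<Rightarrow> real" where
  "tensor_coef A B c d = (\<lambda>S. if S \<subseteq> A \<union> B then c (S \<inter> A) * d (S \<inter> B) else 0)"

definition supp :: "('a set \<Rightarrow> real) \<Rightarrow> 'a set set" where
  "supp c = {S. c S \<noteq> 0}"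

text \<open>\<open>A - {j}\<close> is the set of zeros of the unit string at
  \<open>j\<close>.\<close>

definition outs :: "'a set \<Rightarrow> ('a set \<Rightarrow> real) \<Rightarrow> 'a set" where
  "outs A c = {j \<in> A. zeta c (A - {j}) = 1}"

text \<open>Arbitrary disjoint label sets take over the role of both concatenation and permutations;
  bijections with \<open>{1..n}\<close> lead back to strings.\<close>

inductive type_coef :: "'a set \<Rightarrow> ('a set \<Rightarrow> real) \<Rightarrow> bool" where
  one: "type_coef {a} (single {})"
| star: "type_coef A c \<Longrightarrow> type_coef A (star_coef A c)"
| tensor: "type_coef A c \<Longrightarrow> type_coef B d \<Longrightarrow> A \<inter> B = {} \<Longrightarrow>
    type_coef (A \<union> B) (tensor_coef A B c d)"

lemma zeta_empty [simp]: "zeta c {} = c {}"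
  by (simp add: zeta_def)

lemma zeta_add: "zeta (\<lambda>S. c S + d S) T = zeta c T + zeta d T"
  by (simp add: zeta_def sum.distrib)

lemma zeta_diff: "zeta (\<lambda>S. c S - d S) T = zeta c T - zeta d T"
  by (simp add: zeta_def sum_subtractf)

lemma zeta_single: "finite T \<Longrightarrow> zeta (single S) T = of_bool (S \<subseteq> T)"
  by (simp add: zeta_def single_def of_bool_def)

lemma zeta_star:
  "finite A \<Longrightarrow> T \<subseteq> A \<Longrightarrow> zeta (star_coef A c) T = 1 + of_bool (T = A) - zeta c T"
  using finite_subset[of T A]
  by (auto simp: star_coef_def zeta_add zeta_diff zeta_single of_bool_def)

lemma zeta_supp:
  assumes "supp c \<subseteq> Pow A" "finite T"
  shows "zeta c T = zeta c (T \<inter> A)"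
  unfolding zeta_def using assms by (intro sum.mono_neutral_right) (auto simp: supp_def)

text \<open>Subsets of \<open>T\<close> are pairs of a subset of \<open>T \<inter> A\<close> and one
  of \<open>T \<inter> B\<close>, so the sum factors.\<close>

lemma zeta_tensor:
  assumes "finite A" "finite B" "A \<inter> B = {}" "T \<subseteq> A \<union> B"
  shows "zeta (tensor_coef A B c d) T = zeta c (T \<inter> A) * zeta d (T \<inter> B)"
proof -
  have "zeta c (T \<inter> A) * zeta d (T \<inter> B) =
      (\<Sum>(S, S')\<in>Pow (T \<inter> A) \<times> Pow (T \<inter> B). c S * d S')"
    by (simp add: zeta_def sum_product sum.cartesian_product)
  also have "\<dots> = (\<Sum>S\<in>Pow T. c (S \<inter> A) * d (S \<inter> B))"
    using assms(3,4)
    by (intro sum.reindex_bij_witness[of _ "\<lambda>S. (S \<inter> A, S \<inter> B)" "\<lambda>(S, S'). S \<union> S'"])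
      (auto simp: Int_Un_distrib2 Int_absorb2, (rule arg_cong2[where f = "\<lambda>x y. c x * d y"]; blast)+)
  also have "\<dots> = zeta (tensor_coef A B c d) T"
    unfolding zeta_def using assms(4) by (intro sum.cong) (auto simp: tensor_coef_def)
  finally show ?thesis by simp
qed

lemma tensor_coef_commute: "tensor_coef A B c d = tensor_coef B A d c"
  by (auto simp: tensor_coef_def fun_eq_iff Un_commute)

lemma type_coef_basics:
  assumes "type_coef A c"
  shows "finite A" "A \<noteq> {}" "supp c \<subseteq> Pow A" "zeta c A = 1"
    "T \<subseteq> A \<Longrightarrow> zeta c T = 0 \<or> zeta c T = 1"
proof -
  have "finite A \<and> A \<noteq> {} \<and> supp c \<subseteq> Pow A \<and> zeta c A = 1 \<and> (\<forall>T\<subseteq>A. zeta c T = 0 \<or> zeta c T = 1)"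
    using assms
  proof induction
    case (one a)
    have "finite T" if "T \<subseteq> {a}" for T using that finite_subset by blast
    then show ?case by (auto simp: supp_def single_def[of "{}"] zeta_single[unfolded single_def])
  next
    case (star A c)
    then show ?case
      by (auto simp: zeta_star) (auto simp: supp_def star_coef_def single_def of_bool_def split: if_splits)
  next
    case (tensor A c B d)
    have "zeta (tensor_coef A B c d) T = zeta c (T \<inter> A) * zeta d (T \<inter> B)" if "T \<subseteq> A \<union> B" for T
      using tensor that by (intro zeta_tensor) auto
    moreover have "(A \<union> B) \<inter> A = A" "(A \<union> B) \<inter> B = B" by auto
    ultimately have "zeta (tensor_coef A B c d) (A \<union> B) = 1"
      "\<forall>T\<subseteq>A \<union> B. zeta (tensor_coef A B c d) T = 0 \<or> zeta (tensor_coef A B c d) T = 1"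
      using tensor.IH by auto (metis inf_le2 mult_1)
    then show ?case using tensor.IH by (auto simp: supp_def tensor_coef_def split: if_splits)
  qed
  then show "finite A" "A \<noteq> {}" "supp c \<subseteq> Pow A" "zeta c A = 1"
    "T \<subseteq> A \<Longrightarrow> zeta c T = 0 \<or> zeta c T = 1" by auto
qed

lemma outs_star:
  "finite A \<Longrightarrow> outs A (star_coef A c) = {j \<in> A. zeta c (A - {j}) = 0}"
  unfolding outs_def by (auto simp: zeta_star)

text \<open>A unit string of the concatenation is a unit string on one side and the zero string on
  the other, where the factor has value 1.\<close>

lemma outs_tensor:
  assumes "type_coef A c" "type_coef B d" "A \<inter> B = {}"
  shows "outs (A \<union> B) (tensor_coef A B c d) = outs A c \<union> outs B d"
proof -
  note [simp] = type_coef_basics(1,4)[OF assms(1)] type_coef_basics(1,4)[OF assms(2)]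
  have zt: "zeta (tensor_coef A B c d) (A \<union> B - {j}) = zeta c (A - {j}) * zeta d (B - {j})" for j
  proof -
    have "(A \<union> B - {j}) \<inter> A = A - {j}" "(A \<union> B - {j}) \<inter> B = B - {j}" using assms(3) by auto
    then show ?thesis using zeta_tensor[of A B "A \<union> B - {j}" c d] assms(3) by auto
  qed
  have "B - {j} = B" if "j \<in> A" for j using that assms(3) by auto
  moreover have "A - {j} = A" if "j \<in> B" for j using that assms(3) by auto
  ultimately show ?thesis unfolding outs_def using zt by auto
qed

text \<open>In the paper's notation these are the bounds $p_{I_f} \le f \le p_{O_f}^*$.\<close>

lemma type_coef_bounds:
  assumes "type_coef A c" "T \<subseteq> A"
  shows "A - outs A c \<subseteq> T \<Longrightarrow> zeta c T = 1"
    and "T \<noteq> A \<Longrightarrow> outs A c \<subseteq> T \<Longrightarrow> zeta c T = 0"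
proof -
  have "(A - outs A c \<subseteq> T \<longrightarrow> zeta c T = 1) \<and> (T \<noteq> A \<and> outs A c \<subseteq> T \<longrightarrow> zeta c T = 0)"
    using assms
  proof (induction arbitrary: T)
    case (one a)
    then have "finite T" using finite_subset by blast
    moreover have "outs {a} (single {}) = {a}" by (auto simp: outs_def single_def)
    ultimately show ?case using one by (auto simp: zeta_single)
  next
    case (star A c)
    note basics = type_coef_basics[OF star.hyps]
    \<comment> \<open>Star exchanges inputs and outputs, so each bound for
      \<open>star_coef A c\<close> follows from the opposite bound for \<open>c\<close>.\<close>
    have "A - outs A (star_coef A c) = outs A c"
      using basics(1) basics(5)[of "A - {j}" for j] by (auto simp: outs_star) (auto simp: outs_def)
    moreover have "outs A (star_coef A c) = A - outs A c"
      using basics(1) basics(5)[of "A - {j}" for j] by (auto simp: outs_star) (auto simp: outs_def)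
    ultimately show ?case
      using star.IH[OF star.prems] star.prems basics(1,4) by (auto simp: zeta_star)
  next
    case (tensor A c B d)
    note fin = type_coef_basics(1)[OF tensor.hyps(1)] type_coef_basics(1)[OF tensor.hyps(2)]
    have "A \<union> B - outs (A \<union> B) (tensor_coef A B c d) \<subseteq> T \<Longrightarrow>
        A - outs A c \<subseteq> T \<inter> A \<and> B - outs B d \<subseteq> T \<inter> B"
      using tensor.hyps by (auto simp: outs_tensor) (auto simp: outs_def)
    moreover have "outs (A \<union> B) (tensor_coef A B c d) \<subseteq> T \<Longrightarrow> outs A c \<subseteq> T \<inter> A \<and> outs B d \<subseteq> T \<inter> B"
      using tensor.hyps by (auto simp: outs_tensor) (auto simp: outs_def)
    \<comment> \<open>A proper \<open>T\<close> misses a label on one side, and the zero of that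
      factor makes the product vanish.\<close>
    moreover have "T \<noteq> A \<union> B \<Longrightarrow> T \<inter> A \<noteq> A \<or> T \<inter> B \<noteq> B" using tensor.prems by auto
    ultimately show ?case
      using tensor.IH[of "T \<inter> A"] tensor.IH(2)[of "T \<inter> B"] fin tensor.hyps(3) tensor.prems
      by (auto simp: zeta_tensor)
  qed
  then show "A - outs A c \<subseteq> T \<Longrightarrow> zeta c T = 1"
    and "T \<noteq> A \<Longrightarrow> outs A c \<subseteq> T \<Longrightarrow> zeta c T = 0" by auto
qed

subsection \<open>Maximal chains and reduced posets\<close>

text \<open>An element of \<open>Q\<close> comparable to all of \<open>C\<close> could be added to
  \<open>C\<close>, and members of a larger chain are such elements. This elementwise form is what
  all later arguments on maximal chains use.\<close>

lemma maxchain_iff: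
  "subset.maxchain Q C \<longleftrightarrow> C = {X \<in> Q. \<forall>Y\<in>C. X \<subseteq> Y \<or> Y \<subseteq> X}"
proof
  assume C: "subset.maxchain Q C"
  then have chain: "C \<subseteq> Q" "\<And>X Y. X \<in> C \<Longrightarrow> Y \<in> C \<Longrightarrow> X \<subseteq> Y \<or> Y \<subseteq> X"
    unfolding subset.maxchain_def subset_chain_def by auto
  have "X \<in> C" if "X \<in> Q" "\<forall>Y\<in>C. X \<subseteq> Y \<or> Y \<subseteq> X" for X
  proof (rule ccontr)
    assume "X \<notin> C"
    moreover have "subset.chain Q (insert X C)"
      unfolding subset_chain_def using chain that by blast
    ultimately show False using C unfolding subset.maxchain_def by blast
  qed
  with chain show "C = {X \<in> Q. \<forall>Y\<in>C. X \<subseteq> Y \<or> Y \<subseteq> X}" by blast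
next
  assume C: "C = {X \<in> Q. \<forall>Y\<in>C. X \<subseteq> Y \<or> Y \<subseteq> X}"
  have "\<not> C \<subset> S" if "subset.chain Q S" for S
  proof
    assume "C \<subset> S"
    have "X \<in> C" if "X \<in> S" for X
    proof -
      have "X \<in> Q" "\<forall>Y\<in>C. X \<subseteq> Y \<or> Y \<subseteq> X"
        using \<open>subset.chain Q S\<close> \<open>C \<subset> S\<close> \<open>X \<in> S\<close> unfolding subset_chain_def by blast+
      then show ?thesis by (subst C) blast
    qed
    then show False using \<open>C \<subset> S\<close> by blast
  qed
  moreover have "subset.chain Q C" unfolding subset_chain_def using C by blast
  ultimately show "subset.maxchain Q C" unfolding subset.maxchain_def by blast
qed

lemma finite_maxchains: "finite Q \<Longrightarrow> finite {C. subset.maxchain Q C}"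
  by (rule finite_subset[of _ "Pow Q"]) (auto simp: subset.maxchain_def subset_chain_def)

lemma card_maxchains_pos:
  assumes "finite Q"
  shows "card {C. subset.maxchain Q C} > 0"
proof -
  obtain C where "subset.maxchain Q C" using subset.Hausdorff[of Q] by blast
  then show ?thesis using finite_maxchains[OF assms] card_gt_0_iff by blast
qed

text \<open>An element comparable to everything lies in every maximal chain, so deleting and
  reinserting it are inverse to each other.\<close>

lemma card_maxchains_remove:
  assumes "\<And>Y. Y \<in> Q \<Longrightarrow> X \<subseteq> Y \<or> Y \<subseteq> X"
  shows "card {C. subset.maxchain (Q - {X}) C} = card {C. subset.maxchain Q C}"
proof (cases "X \<in> Q")
  case True
  have "bij_betw (insert X) {C. subset.maxchain (Q - {X}) C} {C. subset.maxchain Q C}"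
  proof (rule bij_betwI[where g = "\<lambda>C. C - {X}"])
    show "insert X \<in> {C. subset.maxchain (Q - {X}) C} \<rightarrow> {C. subset.maxchain Q C}"
      unfolding maxchain_iff using True assms by blast
    show "(\<lambda>C. C - {X}) \<in> {C. subset.maxchain Q C} \<rightarrow> {C. subset.maxchain (Q - {X}) C}"
      unfolding maxchain_iff using True assms by blast
    show "insert X C - {X} = C" if "C \<in> {C. subset.maxchain (Q - {X}) C}" for C
      using that unfolding maxchain_iff by blast
    show "insert X (C - {X}) = C" if "C \<in> {C. subset.maxchain Q C}" for C
      using that True assms unfolding maxchain_iff by blast
  qed
  then show ?thesis by (rule bij_betw_same_card)
qed simp

lemma inj_on_maxchains:
  assumes "inj_on f Q"
  shows "inj_on ((`) f) {C. subset.maxchain Q C}"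
  by (rule inj_onI, rule inj_on_image_eq_iff[THEN iffD1, OF assms])
    (auto simp: subset.maxchain_def subset_chain_def)

text \<open>\<open>f\<close> is an order isomorphism onto its image, hence carries maximal chains
  injectively to maximal chains.\<close>

lemma card_maxchains_image_le:
  assumes "finite Q" and f: "\<And>X Y. X \<in> Q \<Longrightarrow> Y \<in> Q \<Longrightarrow> f X \<subseteq> f Y \<longleftrightarrow> X \<subseteq> Y"
  shows "card {C. subset.maxchain Q C} \<le> card {C. subset.maxchain (f ` Q) C}"
proof (rule card_inj_on_le)
  have "inj_on f Q" using f by (intro inj_onI) (metis subset_antisym order_refl)
  then show "inj_on ((`) f) {C. subset.maxchain Q C}" by (rule inj_on_maxchains)
  show "(`) f ` {C. subset.maxchain Q C} \<subseteq> {C. subset.maxchain (f ` Q) C}"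
  proof (clarify)
    fix C assume "subset.maxchain Q C"
    then have C: "C = {X \<in> Q. \<forall>Y\<in>C. X \<subseteq> Y \<or> Y \<subseteq> X}" unfolding maxchain_iff .
    then have "C \<subseteq> Q" by blast
    then have cmp: "f X \<subseteq> f Y \<or> f Y \<subseteq> f X \<longleftrightarrow> X \<subseteq> Y \<or> Y \<subseteq> X" if "X \<in> Q" "Y \<in> C" for X Y
      using that f by blast
    show "subset.maxchain (f ` Q) (f ` C)"
      unfolding maxchain_iff
    proof (intro equalityI subsetI)
      fix Z assume "Z \<in> f ` C"
      then obtain X where X: "X \<in> C" "Z = f X" by blast
      then have "X \<in> Q" "\<forall>Y\<in>C. X \<subseteq> Y \<or> Y \<subseteq> X" using C by blast+
      then show "Z \<in> {X \<in> f ` Q. \<forall>Y\<in>f ` C. X \<subseteq> Y \<or> Y \<subseteq> X}" using X(2) cmp by simp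
    next
      fix Z assume "Z \<in> {X \<in> f ` Q. \<forall>Y\<in>f ` C. X \<subseteq> Y \<or> Y \<subseteq> X}"
      then obtain X where X: "X \<in> Q" "Z = f X" "\<forall>Y\<in>C. f X \<subseteq> f Y \<or> f Y \<subseteq> f X" by auto
      then have "\<forall>Y\<in>C. X \<subseteq> Y \<or> Y \<subseteq> X" using cmp by simp
      then have "X \<in> C" using X(1) by (subst C) simp
      then show "Z \<in> f ` C" using X(2) by simp
    qed
  qed
  show "finite {C. subset.maxchain (f ` Q) C}" using assms(1) by (intro finite_maxchains) simp
qed

definition new_at :: "('a set \<Rightarrow> real) \<Rightarrow> 'a set \<Rightarrow> 'a set" where
  "new_at c T = T - \<Union> {S \<in> supp c. S \<subset> T}"

definition red :: "('a set \<Rightarrow> real) \<Rightarrow> 'a set set" where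
  "red c = {T \<in> supp c. T = {} \<or> new_at c T \<noteq> {}}"

text \<open>These sets belong to the reduced poset, since nothing lies below them to account for
  their labels; they are the admissible partners in the reduced poset of a tensor product.\<close>

definition mins :: "('a set \<Rightarrow> real) \<Rightarrow> 'a set set" where
  "mins c = {T \<in> supp c. \<forall>S\<in>supp c. \<not> S \<subset> T}"

lemma red_subset_supp: "red c \<subseteq> supp c"
  by (auto simp: red_def)

lemma minsD: "T \<in> mins c \<Longrightarrow> S \<in> supp c \<Longrightarrow> S \<subseteq> T \<Longrightarrow> S = T"
  by (auto simp: mins_def)

lemma mins_subset_supp: "mins c \<subseteq> supp c"
  by (auto simp: mins_def)

lemma mins_subset_red: "mins c \<subseteq> red c"
  by (auto simp: mins_def red_def new_at_def)

lemma empty_in_mins: "{} \<in> supp c \<Longrightarrow> {} \<in> mins c"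
  by (auto simp: mins_def)

lemma finite_supp: "supp c \<subseteq> Pow A \<Longrightarrow> finite A \<Longrightarrow> finite (supp c)"
  using finite_subset by blast

lemma ex_mins_below:
  assumes "finite (supp c)" "T \<in> supp c"
  shows "\<exists>S\<in>mins c. S \<subseteq> T"
proof -
  obtain S where "S \<in> supp c" "S \<subseteq> T" "\<forall>U\<in>supp c. U \<subseteq> S \<longrightarrow> S = U"
    using finite_has_minimal2[OF assms] by blast
  then show ?thesis unfolding mins_def by (intro bexI[of _ S]) auto
qed

text \<open>A minimal nonempty member of the support has at most the empty set below it, so all its
  labels are new.\<close>

lemma ex_red_below:
  assumes "finite (supp c)" "T \<in> supp c" "T \<noteq> {}"
  shows "\<exists>S\<in>red c. S \<noteq> {} \<and> S \<subseteq> T"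
proof -
  obtain S where S: "S \<in> supp c - {{}}" "S \<subseteq> T" "\<forall>U\<in>supp c - {{}}. U \<subseteq> S \<longrightarrow> S = U"
    using finite_has_minimal2[of "supp c - {{}}" T] assms by blast
  have "U = {}" if "U \<in> supp c" "U \<subset> S" for U using S(3)[rule_format, of U] that by blast
  then have "new_at c S = S" unfolding new_at_def by blast
  moreover have "S \<in> supp c" "S \<noteq> {}" using S(1) by auto
  ultimately show ?thesis using S(2) unfolding red_def by blast
qed

text \<open>Off \<open>{}\<close> and \<open>A\<close>, star only changes the sign of the
  coefficients. New labels below \<open>A\<close> do not change either: \<open>{}\<close>
  contributes nothing to a union and \<open>A\<close> is never strictly below
  \<open>T\<close>.\<close>

lemma red_star:
  "supp c \<subseteq> Pow A \<Longrightarrow> red (star_coef A c) - {{}, A} = red c - {{}, A}"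
proof -
  assume sub: "supp c \<subseteq> Pow A"
  have supp: "S \<in> supp (star_coef A c) \<longleftrightarrow> S \<in> supp c" if "S \<noteq> {}" "S \<noteq> A" for S
    using that by (auto simp: supp_def star_coef_def single_def)
  have new: "new_at (star_coef A c) T = new_at c T" if "T \<subseteq> A" for T
  proof -
    have "\<Union> {S \<in> supp (star_coef A c). S \<subset> T} = \<Union> ({S \<in> supp (star_coef A c). S \<subset> T} - {{}})"
      by blast
    also have "{S \<in> supp (star_coef A c). S \<subset> T} - {{}} = {S \<in> supp c. S \<subset> T} - {{}}"
      using supp that by blast
    also have "\<Union> \<dots> = \<Union> {S \<in> supp c. S \<subset> T}" by blast
    finally show ?thesis by (simp add: new_at_def)
  qed
  have "T \<in> red (star_coef A c) \<longleftrightarrow> T \<in> red c" if T: "T \<noteq> {}" "T \<noteq> A" for T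
  proof (cases "T \<in> supp c")
    case True
    then have "T \<subseteq> A" using sub by blast
    then show ?thesis using supp[OF T] new by (simp add: red_def)
  qed (use supp[OF T] in \<open>simp add: red_def\<close>)
  then show ?thesis by blast
qed

text \<open>Both \<open>{}\<close> and \<open>A\<close> are comparable to every subset of
  \<open>A\<close>, so they can be removed from both posets, which then coincide.\<close>

lemma card_maxchains_star:
  assumes "type_coef A c"
  shows "card {C. subset.maxchain (red (star_coef A c)) C} = card {C. subset.maxchain (red c) C}"
proof -
  have *: "card {C. subset.maxchain (red d - {{}, A}) C} = card {C. subset.maxchain (red d) C}"
    if "type_coef A d" for d :: "'a set \<Rightarrow> real"
  proof -
    have "red d \<subseteq> Pow A" using type_coef_basics(3)[OF that] red_subset_supp[of d] by blast
    then show ?thesis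
      using card_maxchains_remove[of "red d" "{}"] card_maxchains_remove[of "red d - {{}}" A]
      by (auto simp: Diff_insert2[symmetric] insert_commute)
  qed
  show ?thesis
    using *[OF assms] *[OF type_coef.star[OF assms]] red_star[OF type_coef_basics(3)[OF assms]] by simp
qed

text \<open>The value at \<open>T\<close> is \<open>c T\<close>, which is nonzero and hence 1; the
  value at \<open>A\<close> is \<open>c T + c A = 1\<close>, so \<open>c A\<close> vanishes.\<close>

lemma single_if_supp:
  assumes c: "type_coef A c" and sub: "supp c \<subseteq> {T, A}" and T: "T \<in> supp c" "T \<noteq> A"
  shows "c = single T"
proof -
  note b = type_coef_basics[OF c]
  have TA: "T \<subset> A" using b(3) T by blast
  have 0: "c S = 0" if "S \<noteq> T" "S \<noteq> A" for S using that sub by (auto simp: supp_def)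
  have "zeta c T = (\<Sum>S\<in>{T}. c S)"
    unfolding zeta_def using TA 0 b(1) finite_subset[of T A] by (intro sum.mono_neutral_right) auto
  moreover have "zeta c A = (\<Sum>S\<in>{T, A}. c S)"
    unfolding zeta_def using TA 0 b(1) by (intro sum.mono_neutral_right) auto
  ultimately have "c T = 1" "c A = 0"
    using b(4) b(5)[of T] T TA by (auto simp: supp_def)
  with 0 show ?thesis by (auto simp: single_def fun_eq_iff)
qed

lemma single_if_supp_top:
  assumes c: "type_coef A c" and sub: "supp c \<subseteq> {A}"
  shows "c = single A"
proof -
  note b = type_coef_basics[OF c]
  have 0: "c S = 0" if "S \<noteq> A" for S using that sub by (auto simp: supp_def)
  have "zeta c A = (\<Sum>S\<in>{A}. c S)"
    unfolding zeta_def using 0 b(1) by (intro sum.mono_neutral_right) auto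
  with 0 b(4) show ?thesis by (auto simp: single_def fun_eq_iff)
qed

lemma supp_single: "supp (single T) = {T}"
  by (auto simp: supp_def single_def)

lemma red_single: "red (single T) = {T}" and mins_single: "mins (single T) = {T}"
  by (auto simp: red_def mins_def supp_single new_at_def)

section \<open>The reduced poset of a tensor product\<close>

context
  fixes A B :: "'a set" and c d :: "'a set \<Rightarrow> real"
  assumes disj: "A \<inter> B = {}" and supp: "supp c \<subseteq> Pow A" "supp d \<subseteq> Pow B"
begin

lemma supp_tensor_iff:
  "X \<in> supp (tensor_coef A B c d) \<longleftrightarrow> X \<subseteq> A \<union> B \<and> X \<inter> A \<in> supp c \<and> X \<inter> B \<in> supp d"
  by (auto simp: supp_def tensor_coef_def)

lemma Un_Int_parts: "T \<subseteq> A \<Longrightarrow> S \<subseteq> B \<Longrightarrow> (T \<union> S) \<inter> A = T \<and> (T \<union> S) \<inter> B = S"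
  using disj by blast

lemma Un_in_supp_tensor: "T \<in> supp c \<Longrightarrow> S \<in> supp d \<Longrightarrow> T \<union> S \<in> supp (tensor_coef A B c d)"
  using supp Un_Int_parts[of T S] unfolding supp_tensor_iff by (metis PowD Un_mono subsetD)

text \<open>A new label \<open>i\<close> of \<open>T\<close> stays new at
  \<open>T \<union> S\<close>: a member of the support that contains \<open>i\<close> and lies below
  has \<open>A\<close>-part \<open>T\<close> because \<open>i\<close> is new, and
  \<open>B\<close>-part \<open>S\<close> by minimality. For empty \<open>T\<close>, minimality of
  \<open>S\<close> leaves nothing strictly below.\<close>

lemma red_tensor_sufficient:
  assumes T: "T \<in> red c" and S: "S \<in> mins d"
  shows "T \<union> S \<in> red (tensor_coef A B c d)"
proof -
  have supps: "T \<in> supp c" "S \<in> supp d" "T \<subseteq> A" "S \<subseteq> B"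
    using T S red_subset_supp[of c] mins_subset_supp[of d] supp by auto
  then have mem: "T \<union> S \<in> supp (tensor_coef A B c d)" by (intro Un_in_supp_tensor)
  have "T \<union> S = {} \<or> new_at (tensor_coef A B c d) (T \<union> S) \<noteq> {}"
  proof (cases "T = {}")
    case True
    have "\<not> X \<subset> S" if "X \<in> supp (tensor_coef A B c d)" for X
    proof
      assume "X \<subset> S"
      then have "X \<inter> B = X" using supps by auto
      then show False using that minsD[OF S, of X] \<open>X \<subset> S\<close> by (auto simp: supp_tensor_iff)
    qed
    then show ?thesis using True by (auto simp: new_at_def)
  next
    case False
    then obtain i where i: "i \<in> new_at c T" using T by (auto simp: red_def)
    have "i \<notin> X" if X: "X \<in> supp (tensor_coef A B c d)" "X \<subset> T \<union> S" for X
    proof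
      assume iX: "i \<in> X"
      have XA: "X \<inter> A \<subseteq> T" "X \<inter> B \<subseteq> S" using X(2) supps disj by blast+
      have "X \<inter> A \<in> supp c" "X \<inter> B \<in> supp d" "X \<subseteq> A \<union> B" using X(1) by (auto simp: supp_tensor_iff)
      moreover from this have "\<not> X \<inter> A \<subset> T" using i iX supps(3) unfolding new_at_def by blast
      then have "X \<inter> A = T" using XA by blast
      moreover have "X \<inter> B = S" using minsD[OF S] XA calculation by blast
      ultimately show False using X(2) by blast
    qed
    then have "i \<in> new_at (tensor_coef A B c d) (T \<union> S)" using i by (auto simp: new_at_def)
    then show ?thesis by blast
  qed
  with mem show ?thesis by (auto simp: red_def)
qed

text \<open>If the \<open>A\<close>-part had a smaller member of the support containing
  \<open>i\<close>, or the \<open>B\<close>-part any smaller member, then replacing that part would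
  give a smaller element containing the new label \<open>i\<close>.\<close>

lemma red_tensor_necessary:
  assumes X: "X \<in> red (tensor_coef A B c d)" and i: "X = {} \<or> i \<in> new_at (tensor_coef A B c d) X \<inter> A"
  shows "X \<inter> A \<in> red c \<and> X \<inter> B \<in> mins d"
proof -
  have mem: "X \<subseteq> A \<union> B" "X \<inter> A \<in> supp c" "X \<inter> B \<in> supp d"
    using X red_subset_supp[of "tensor_coef A B c d"] supp_tensor_iff[of X] by auto
  show ?thesis
  proof (cases "X = {}")
    case True
    then show ?thesis using mem empty_in_mins[of c] empty_in_mins[of d] mins_subset_red[of c] by auto
  next
    case False
    with i have iX: "i \<in> X" "i \<in> A"
      and new: "\<And>Y. Y \<in> supp (tensor_coef A B c d) \<Longrightarrow> Y \<subset> X \<Longrightarrow> i \<notin> Y"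
      by (auto simp: new_at_def)
    have "i \<notin> T" if "T \<in> supp c" "T \<subset> X \<inter> A" for T
      using new[of "T \<union> (X \<inter> B)"] Un_in_supp_tensor[OF that(1) mem(3)] that(2) disj by blast
    then have "i \<in> new_at c (X \<inter> A)" using iX by (auto simp: new_at_def)
    moreover have "\<not> S \<subset> X \<inter> B" if "S \<in> supp d" for S
      using new[of "(X \<inter> A) \<union> S"] Un_in_supp_tensor[OF mem(2) that] iX disj by blast
    ultimately show ?thesis using mem by (auto simp: red_def mins_def)
  qed
qed

end

text \<open>A new label lies in \<open>A\<close> or in \<open>B\<close>; the second case is the
  first one with the factors exchanged.\<close>

lemma red_tensor_cases:
  assumes "A \<inter> B = {}" "supp c \<subseteq> Pow A" "supp d \<subseteq> Pow B" and X: "X \<in> red (tensor_coef A B c d)"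
  shows "X \<subseteq> A \<union> B \<and>
    (X \<inter> A \<in> red c \<and> X \<inter> B \<in> mins d \<or> X \<inter> A \<in> mins c \<and> X \<inter> B \<in> red d)"
proof -
  have mem: "X \<subseteq> A \<union> B"
    using X red_subset_supp[of "tensor_coef A B c d"] supp_tensor_iff[OF assms(1-3), of X] by auto
  consider "X = {}" | i where "i \<in> new_at (tensor_coef A B c d) X"
    using X by (auto simp: red_def)
  then show ?thesis
  proof cases
    case 1
    then show ?thesis using red_tensor_necessary[OF assms(1-3) X] mem by blast
  next
    case (2 i)
    then have "i \<in> X" by (auto simp: new_at_def)
    then consider "i \<in> A" | "i \<in> B" using mem by blast
    then show ?thesis
    proof cases
      case 1
      then show ?thesis using red_tensor_necessary[OF assms(1-3) X] mem 2 by blast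
    next
      case i: 2
      have X': "X \<in> red (tensor_coef B A d c)" using X by (simp add: tensor_coef_commute)
      have "i \<in> new_at (tensor_coef B A d c) X \<inter> B" using i 2 by (simp add: tensor_coef_commute)
      then show ?thesis using red_tensor_necessary[OF _ assms(3,2) X'] assms(1) mem by (blast)
    qed
  qed
qed

lemma red_tensor_sufficient':
  assumes "A \<inter> B = {}" "supp c \<subseteq> Pow A" "supp d \<subseteq> Pow B" "T \<in> mins c" "S \<in> red d"
  shows "T \<union> S \<in> red (tensor_coef A B c d)"
  using red_tensor_sufficient[of B A d c S T] assms
  by (simp add: tensor_coef_commute Int_commute Un_commute)

subsection \<open>Isolated elements of the reduced poset\<close>

text \<open>The possible exceptions \<open>{}\<close> and \<open>A\<close> make the property of \<open>c\<close> in this definition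
  invariant under \<open>star_coef A\<close>, so that it can be proved by induction over type functions.\<close>

definition isolated_only :: "'a set \<Rightarrow> ('a set \<Rightarrow> real) \<Rightarrow> bool" where
  "isolated_only A c \<longleftrightarrow> (\<forall>T\<in>supp c. T \<noteq> {} \<longrightarrow> T \<noteq> A \<longrightarrow>
     (\<forall>S\<in>red c. S \<subseteq> T \<or> T \<subseteq> S \<longrightarrow> S = {} \<or> S = T \<or> S = A) \<longrightarrow> supp c \<subseteq> {{}, T, A})"

lemma isolated_onlyD:
  "isolated_only A c \<Longrightarrow> T \<in> supp c \<Longrightarrow> T \<noteq> {} \<Longrightarrow> T \<noteq> A \<Longrightarrow>
    (\<And>S. S \<in> red c \<Longrightarrow> S \<subseteq> T \<or> T \<subseteq> S \<Longrightarrow> S = {} \<or> S = T \<or> S = A) \<Longrightarrow>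
    supp c \<subseteq> {{}, T, A}"
  by (auto simp: isolated_only_def)

text \<open>Below each nonempty member of the support there is a nonempty reduced one, which can
  only be \<open>A\<close>.\<close>

lemma supp_subset_if_red_subset:
  assumes "finite (supp c)" "supp c \<subseteq> Pow A" "red c \<subseteq> {{}, A}"
  shows "supp c \<subseteq> {{}, A}"
proof
  fix T assume T: "T \<in> supp c"
  show "T \<in> {{}, A}"
  proof (cases "T = {}")
    case False
    then obtain S where "S \<in> red c" "S \<noteq> {}" "S \<subseteq> T" using ex_red_below[OF assms(1) T] by blast
    then show ?thesis using assms T by blast
  qed simp
qed

text \<open>This is the form in which \<open>isolated_only\<close> is applied. If \<open>T\<close>
  is empty, everything is comparable to it and the reduced poset has at most \<open>{}\<close> and
  \<open>A\<close>; otherwise minimality of \<open>T\<close> removes \<open>{}\<close> from the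
  three sets that \<open>isolated_only\<close> allows.\<close>

lemma single_if_isolated:
  assumes c: "type_coef A c" "isolated_only A c" and T: "T \<in> mins c" "T \<noteq> A"
    and iso: "\<And>S. S \<in> red c \<Longrightarrow> S \<subseteq> T \<or> T \<subseteq> S \<Longrightarrow> S = T \<or> S = A"
  shows "c = single T"
proof -
  note b = type_coef_basics[OF c(1)]
  have Ts: "T \<in> supp c" using T mins_subset_supp by blast
  have "supp c \<subseteq> {T, A}"
  proof (cases "T = {}")
    case True
    then have "red c \<subseteq> {{}, A}" using iso by blast
    then show ?thesis using supp_subset_if_red_subset[OF finite_supp[OF b(3,1)] b(3)] True by simp
  next
    case False
    have "{} \<notin> supp c" using minsD[OF T(1), of "{}"] False by auto
    moreover have "supp c \<subseteq> {{}, T, A}" using isolated_onlyD[OF c(2) Ts False T(2)] iso by blast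
    ultimately show ?thesis by blast
  qed
  then show ?thesis by (rule single_if_supp[OF c(1) _ Ts T(2)])
qed

lemma single_if_isolated_top:
  assumes c: "type_coef A c" and A: "A \<in> mins c"
  shows "c = single A"
proof (rule single_if_supp_top[OF c])
  have "S = A" if "S \<in> supp c" for S
    using minsD[OF A that] type_coef_basics(3)[OF c] that by blast
  then show "supp c \<subseteq> {A}" by blast
qed

lemma isolated_only_star:
  assumes "type_coef A c" "isolated_only A c"
  shows "isolated_only A (star_coef A c)"
  unfolding isolated_only_def
proof (intro ballI impI)
  fix T assume T: "T \<in> supp (star_coef A c)" "T \<noteq> {}" "T \<noteq> A"
    and iso: "\<forall>S\<in>red (star_coef A c). S \<subseteq> T \<or> T \<subseteq> S \<longrightarrow> S = {} \<or> S = T \<or> S = A"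
  have eq: "S \<in> supp (star_coef A c) \<longleftrightarrow> S \<in> supp c" if "S \<noteq> {}" "S \<noteq> A" for S
    using that by (auto simp: supp_def star_coef_def single_def)
  have "supp c \<subseteq> {{}, T, A}"
  proof (rule isolated_onlyD[OF assms(2)])
    show "T \<in> supp c" using eq T by blast
    show "S = {} \<or> S = T \<or> S = A" if "S \<in> red c" "S \<subseteq> T \<or> T \<subseteq> S" for S
      using that iso red_star[OF type_coef_basics(3)[OF assms(1)]] by blast
  qed (use T in auto)
  then show "supp (star_coef A c) \<subseteq> {{}, T, A}" using eq by blast
qed

section \<open>Isolated elements of a tensor product\<close>

context
  fixes A B :: "'a set" and c d :: "'a set \<Rightarrow> real"
  assumes c: "type_coef A c" "isolated_only A c" and d: "type_coef B d" "isolated_only B d"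
    and disj: "A \<inter> B = {}"
begin

private lemmas bc = type_coef_basics[OF c(1)]
private lemmas bd = type_coef_basics[OF d(1)]

text \<open>As \<open>{}\<close> is minimal for \<open>d\<close>, the reduced poset of
  \<open>c\<close> embeds into that of the product, and \<open>A \<union> B\<close> is not in the
  image because \<open>B\<close> is nonempty. So \<open>T\<close> is isolated for \<open>c\<close>,
  with \<open>A\<close> no longer an exception, which leaves too few coefficients.\<close>

lemma isolated_tensor_left:
  assumes T: "T \<in> supp c" "T \<noteq> {}" and empty: "{} \<in> supp c" "{} \<in> supp d"
    and iso: "\<And>X. X \<in> red (tensor_coef A B c d) \<Longrightarrow> X \<subseteq> T \<or> T \<subseteq> X \<Longrightarrow> X = {} \<or> X = T \<or> X = A \<union> B"
  shows False
proof -
  have iso': "S = {} \<or> S = T" if "S \<in> red c" "S \<subseteq> T \<or> T \<subseteq> S" for S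
  proof -
    have "S \<in> red (tensor_coef A B c d)"
      using red_tensor_sufficient[OF disj bc(3) bd(3) that(1) empty_in_mins[OF empty(2)]] by simp
    then have "S = {} \<or> S = T \<or> S = A \<union> B" using iso that(2) by blast
    moreover have "S \<subseteq> A" using that(1) red_subset_supp[of c] bc(3) by blast
    ultimately show ?thesis using disj bd(2) by blast
  qed
  have sub: "supp c \<subseteq> {{}, T}"
  proof (cases "T = A")
    case True
    have "red c \<subseteq> Pow A" using red_subset_supp[of c] bc(3) by blast
    then have "red c \<subseteq> {{}, A}" using iso' True by blast
    then show ?thesis using supp_subset_if_red_subset[OF finite_supp[OF bc(3,1)] bc(3)] True by simp
  next
    case False
    have TA: "T \<subset> A" using T(1) False bc(3) by blast
    have sub: "supp c \<subseteq> {{}, T, A}" using isolated_onlyD[OF c(2) T False] iso' by blast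
    have "A \<notin> supp c"
    proof
      assume A: "A \<in> supp c"
      \<comment> \<open>The labels outside \<open>T\<close> would be new at \<open>A\<close>, making
        \<open>A\<close> a reduced element above \<open>T\<close>.\<close>
      have "\<Union> {S \<in> supp c. S \<subset> A} \<subseteq> T" using sub by blast
      then have "new_at c A \<noteq> {}" using TA by (auto simp: new_at_def)
      then have "A \<in> red c" using A by (simp add: red_def)
      then show False using iso'[of A] TA by blast
    qed
    then show ?thesis using sub by blast
  qed
  have "T \<subseteq> A" using T(1) bc(3) by blast
  have 0: "c S = 0" if "S \<noteq> {}" "S \<noteq> T" for S using that sub by (auto simp: supp_def)
  \<comment> \<open>The values at \<open>{}\<close> and at \<open>A\<close> are both 1, which forces
    the coefficient of \<open>T\<close> to be 0.\<close>
  have "zeta c A = (\<Sum>S\<in>{{}, T}. c S)"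
    unfolding zeta_def using \<open>T \<subseteq> A\<close> 0 bc(1) by (intro sum.mono_neutral_right) auto
  moreover have "c {} = 0 \<or> c {} = 1" using bc(5)[of "{}"] by simp
  ultimately show False using bc(4) T empty by (auto simp: supp_def)
qed

text \<open>Pairing reduced elements of \<open>c\<close> with \<open>S\<close>, and those of
  \<open>d\<close> with \<open>T\<close>, transfers isolation to the factors. Since
  \<open>S \<noteq> B\<close>, the exception \<open>A \<union> B\<close> cannot arise from a pair
  with \<open>S\<close>.\<close>

lemma isolated_tensor_mins:
  assumes T: "T \<in> mins c" and S: "S \<in> mins d" "S \<noteq> B" and ne: "{} \<notin> supp (tensor_coef A B c d)"
    and iso: "\<And>X. X \<in> red (tensor_coef A B c d) \<Longrightarrow> X \<subseteq> T \<union> S \<or> T \<union> S \<subseteq> X \<Longrightarrow>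
      X = {} \<or> X = T \<union> S \<or> X = A \<union> B"
  shows "c = single T \<and> d = single S"
proof
  have subs: "T \<subseteq> A" "S \<subseteq> B" using T S(1) mins_subset_supp[of c] mins_subset_supp[of d] bc(3) bd(3) by blast+
  have isoT: "T' = T" if "T' \<in> red c" "T' \<subseteq> T \<or> T \<subseteq> T'" for T'
  proof -
    have red: "T' \<union> S \<in> red (tensor_coef A B c d)"
      by (rule red_tensor_sufficient[OF disj bc(3) bd(3) that(1) S(1)])
    moreover have "T' \<union> S \<noteq> {}" using red ne red_subset_supp[of "tensor_coef A B c d"] by fastforce
    ultimately have "T' \<union> S = T \<union> S \<or> T' \<union> S = A \<union> B" using iso that(2) by blast
    moreover have "T' \<subseteq> A" using that(1) red_subset_supp[of c] bc(3) by blast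
    ultimately show ?thesis using disj S(2) subs by blast
  qed
  show cT: "c = single T"
  proof (cases "T = A")
    case True
    then show ?thesis using single_if_isolated_top[OF c(1)] T by blast
  next
    case False
    then show ?thesis using single_if_isolated[OF c T] isoT by blast
  qed
  show "d = single S"
  \<comment> \<open>Here the exception \<open>A \<union> B\<close> can occur, namely for
    \<open>S' = B\<close>; \<open>single_if_isolated\<close> permits it.\<close>
  proof (rule single_if_isolated[OF d S])
    fix S' assume S': "S' \<in> red d" "S' \<subseteq> S \<or> S \<subseteq> S'"
    have red: "T \<union> S' \<in> red (tensor_coef A B c d)"
      by (rule red_tensor_sufficient'[OF disj bc(3) bd(3) T S'(1)])
    moreover have "T \<union> S' \<noteq> {}" using red ne red_subset_supp[of "tensor_coef A B c d"] by fastforce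
    ultimately have "T \<union> S' = T \<union> S \<or> T \<union> S' = A \<union> B" using iso S'(2) by blast
    moreover have "S' \<subseteq> B" using S'(1) red_subset_supp[of d] bd(3) by blast
    ultimately show "S' = S \<or> S' = B" using disj subs by blast
  qed
qed

end

lemma isolated_only_tensor:
  assumes c: "type_coef A c" "isolated_only A c" and d: "type_coef B d" "isolated_only B d"
    and disj: "A \<inter> B = {}"
  shows "isolated_only (A \<union> B) (tensor_coef A B c d)"
  unfolding isolated_only_def
proof (intro ballI impI)
  let ?h = "tensor_coef A B c d"
  note bc = type_coef_basics[OF c(1)] and bd = type_coef_basics[OF d(1)]
  have disj': "B \<inter> A = {}" using disj by blast
  have h': "?h = tensor_coef B A d c" by (rule tensor_coef_commute)
  note supp_iff = supp_tensor_iff[OF disj bc(3) bd(3)]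
  have type_h: "type_coef (A \<union> B) ?h" by (rule type_coef.tensor[OF c(1) d(1) disj])
  note bh = type_coef_basics[OF type_h]
  fix X assume X: "X \<in> supp ?h" "X \<noteq> {}" "X \<noteq> A \<union> B"
    and iso: "\<forall>Y\<in>red ?h. Y \<subseteq> X \<or> X \<subseteq> Y \<longrightarrow> Y = {} \<or> Y = X \<or> Y = A \<union> B"
  have iso': "\<forall>Y\<in>red (tensor_coef B A d c). Y \<subseteq> X \<or> X \<subseteq> Y \<longrightarrow> Y = {} \<or> Y = X \<or> Y = B \<union> A"
    using iso unfolding h' Un_commute[of A B] .
  define T S where "T = X \<inter> A" and "S = X \<inter> B"
  have TS: "X = T \<union> S" "T \<in> supp c" "S \<in> supp d" "T \<subseteq> A" "S \<subseteq> B" using X(1) by (auto simp: supp_iff T_def S_def)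
  \<comment> \<open>A nonempty reduced element below \<open>Y\<close> is comparable to
    \<open>X\<close> and not the full set, so isolation identifies it with \<open>X\<close>.\<close>
  have min: "Y = X" if Y: "Y \<in> supp ?h" "Y \<noteq> {}" "Y \<subseteq> X" for Y
  proof -
    obtain Z where Z: "Z \<in> red ?h" "Z \<noteq> {}" "Z \<subseteq> Y"
      using ex_red_below[OF finite_supp[OF bh(3,1)] Y(1,2)] by blast
    moreover have "X \<subseteq> A \<union> B" using X(1) bh(3) by blast
    ultimately have "Z = X" using iso Y(3) X(3) by blast
    then show ?thesis using Z(3) Y(3) by blast
  qed
  show "supp ?h \<subseteq> {{}, X, A \<union> B}"
  proof (cases "{} \<in> supp ?h")
    case True
    then have e: "{} \<in> supp c" "{} \<in> supp d" by (simp_all add: supp_iff)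
    \<comment> \<open>With \<open>{}\<close> available in both factors, each component of
      \<open>X\<close> is itself in the support, so by minimality \<open>X\<close> is one of its
      components.\<close>
    have "T \<in> supp ?h" "S \<in> supp ?h"
      using Un_in_supp_tensor[OF disj bc(3) bd(3) TS(2) e(2)]
        Un_in_supp_tensor[OF disj bc(3) bd(3) e(1) TS(3)] by simp_all
    then have "T = {} \<or> T = X" "S = {} \<or> S = X" using min TS(1) by blast+
    then consider "X = T" "T \<noteq> {}" | "X = S" "S \<noteq> {}" using TS(1) X(2) by blast
    then show ?thesis
    proof cases
      case 1
      then show ?thesis
        using isolated_tensor_left[OF c d disj TS(2) 1(2) e] iso by blast
    next
      case 2
      have "False"
      proof (rule isolated_tensor_left[OF d c disj' TS(3) 2(2) e(2,1)])
        fix Y assume "Y \<in> red (tensor_coef B A d c)" "Y \<subseteq> S \<or> S \<subseteq> Y"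
        then show "Y = {} \<or> Y = S \<or> Y = B \<union> A" using iso' unfolding 2(1) by blast
      qed
      then show ?thesis ..
    qed
  next
    case False
    \<comment> \<open>A smaller component would give a nonempty member of the support strictly below
      \<open>X\<close>.\<close>
    have "\<not> U \<subset> T" if "U \<in> supp c" for U
    proof
      assume U: "U \<subset> T"
      have "U \<union> S \<in> supp ?h" by (rule Un_in_supp_tensor[OF disj bc(3) bd(3) that TS(3)])
      moreover from this have "U \<union> S \<noteq> {}" using False by metis
      ultimately have "U \<union> S = T \<union> S" using min U TS(1) by blast
      then show False using U TS(4,5) disj by blast
    qed
    then have mT: "T \<in> mins c" using TS by (simp add: mins_def)
    have "\<not> U \<subset> S" if "U \<in> supp d" for U
    proof
      assume U: "U \<subset> S"
      have "T \<union> U \<in> supp ?h" by (rule Un_in_supp_tensor[OF disj bc(3) bd(3) TS(2) that])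
      moreover from this have "T \<union> U \<noteq> {}" using False by metis
      ultimately have "T \<union> U = T \<union> S" using min U TS(1) by blast
      then show False using U TS(4,5) disj by blast
    qed
    then have mS: "S \<in> mins d" using TS by (simp add: mins_def)
    have "c = single T \<and> d = single S"
    \<comment> \<open>As \<open>X\<close> is not the full set, at least one component is proper; the
      previous lemma is applied from that side.\<close>
    proof (cases "S = B")
      case False
      then show ?thesis
        using isolated_tensor_mins[OF c d disj mT mS False \<open>{} \<notin> supp ?h\<close>] iso TS(1) by blast
    next
      case True
      then have TA: "T \<noteq> A" using X TS by blast
      have "d = single S \<and> c = single T"
      proof (rule isolated_tensor_mins[OF d c disj' mS mT TA])
        show "{} \<notin> supp (tensor_coef B A d c)" using False h' by simp
        fix Y assume "Y \<in> red (tensor_coef B A d c)" "Y \<subseteq> S \<union> T \<or> S \<union> T \<subseteq> Y"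
        then show "Y = {} \<or> Y = S \<union> T \<or> Y = B \<union> A"
          using iso' unfolding TS(1) Un_commute[of T S] by blast
      qed
      then show ?thesis by blast
    qed
    then have "supp c = {T}" "supp d = {S}" by (simp_all add: supp_single)
    then have "supp ?h \<subseteq> {X}" using TS(1) by (auto simp: supp_iff)
    then show ?thesis by blast
  qed
qed

lemma isolated_only_type: "type_coef A c \<Longrightarrow> isolated_only A c"
proof (induction rule: type_coef.induct)
  case (one a)
  show ?case by (simp add: isolated_only_def supp_single)
qed (simp_all add: isolated_only_star isolated_only_tensor)

section \<open>Least elements and length of maximal chains\<close>

lemma supp_nonempty: "type_coef A c \<Longrightarrow> supp c \<noteq> {}"
proof
  assume c: "type_coef A c" "supp c = {}"
  then have "zeta c A = 0" unfolding zeta_def by (intro sum.neutral) (auto simp: supp_def)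
  then show False using type_coef_basics(4)[OF c(1)] by simp
qed

lemma ex_mins:
  assumes "type_coef A c"
  shows "\<exists>T\<in>mins c. T \<subseteq> A"
proof -
  note b = type_coef_basics[OF assms]
  obtain U where "U \<in> supp c" using supp_nonempty[OF assms] by blast
  then obtain T where "T \<in> mins c" using ex_mins_below[OF finite_supp[OF b(3,1)]] by blast
  moreover from this have "T \<subseteq> A" using mins_subset_supp[of c] b(3) by blast
  ultimately show ?thesis by blast
qed

text \<open>A minimal element below the least member of the chain is reduced and comparable to the
  whole chain, hence belongs to it.\<close>

lemma maxchain_has_mins:
  assumes "finite (supp c)" "supp c \<noteq> {}" and C: "subset.maxchain (red c) C"
  shows "\<exists>T\<in>C. T \<in> mins c \<and> (\<forall>S\<in>C. T \<subseteq> S)"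
proof -
  have Ceq: "C = {X \<in> red c. \<forall>Y\<in>C. X \<subseteq> Y \<or> Y \<subseteq> X}" using C unfolding maxchain_iff .
  have sub: "C \<subseteq> supp c" using Ceq red_subset_supp[of c] by blast
  then have fin: "finite C" using assms(1) finite_subset by blast
  have chain: "X \<subseteq> Y \<or> Y \<subseteq> X" if "X \<in> C" "Y \<in> C" for X Y using Ceq that by blast
  show ?thesis
  proof (cases "C = {}")
    case True
    then have "red c = {}" using Ceq by simp
    moreover obtain T where "T \<in> mins c" using assms(1,2) ex_mins_below[OF assms(1)] by blast
    ultimately show ?thesis using mins_subset_red[of c] by blast
  next
    case False
    then obtain T where T: "T \<in> C" "\<And>S. S \<in> C \<Longrightarrow> S \<subseteq> T \<Longrightarrow> T = S"
      using finite_has_minimal[OF fin] by metis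
    then have least: "\<forall>S\<in>C. T \<subseteq> S" using chain by blast
    obtain U where U: "U \<in> mins c" "U \<subseteq> T" using ex_mins_below[OF assms(1)] T(1) sub by blast
    then have "U \<in> C" using mins_subset_red[of c] least by (subst Ceq) blast
    then have "U = T" using T(2) U(2) by blast
    then show ?thesis using U T least by blast
  qed
qed

text \<open>The only member of such a chain would be minimal and comparable to no other reduced
  element, which forces \<open>c\<close> to be some \<open>single T\<close>.\<close>

lemma maxchain_not_singleton:
  assumes c: "type_coef A c" and C: "subset.maxchain (red c) C" and ne: "\<And>T. c \<noteq> single T"
  shows "\<not> C \<subseteq> {T}"
proof
  assume CT: "C \<subseteq> {T}"
  note b = type_coef_basics[OF c]
  obtain T' where T': "T' \<in> C" "T' \<in> mins c"
    using maxchain_has_mins[OF finite_supp[OF b(3,1)] supp_nonempty[OF c] C] by blast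
  then have eq: "C = {T}" and T: "T \<in> mins c" using CT by blast+
  have iso: "S = T" if "S \<in> red c" "S \<subseteq> T \<or> T \<subseteq> S" for S
  proof -
    have "C = {X \<in> red c. \<forall>Y\<in>C. X \<subseteq> Y \<or> Y \<subseteq> X}" using C unfolding maxchain_iff .
    then show ?thesis using that eq by blast
  qed
  show False
  proof (cases "T = A")
    case True
    then show ?thesis using single_if_isolated_top[OF c] T ne by blast
  next
    case False
    then show ?thesis using single_if_isolated[OF c isolated_only_type[OF c] T False] iso ne by blast
  qed
qed

subsection \<open>Maximal chains of a tensor product\<close>

text \<open>An element comparable to all \<open>T \<union> S\<close> either has
  \<open>B\<close>-part \<open>S\<close>, so that maximality of \<open>C\<close> applies to its
  \<open>A\<close>-part, or lies above the whole chain with a non-minimal \<open>B\<close>-part. In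
  the latter case its \<open>A\<close>-part is minimal and above all of \<open>C\<close>, which
  would make \<open>C\<close> a singleton.\<close>

lemma maxchain_tensor:
  assumes c: "type_coef A c" and d: "type_coef B d" and disj: "A \<inter> B = {}"
    and C: "subset.maxchain (red c) C" and nsing: "\<And>T. \<not> C \<subseteq> {T}" and S: "S \<in> mins d"
  shows "subset.maxchain (red (tensor_coef A B c d)) ((\<lambda>T. T \<union> S) ` C)"
proof -
  let ?h = "tensor_coef A B c d"
  note bc = type_coef_basics[OF c] and bd = type_coef_basics[OF d]
  have Ceq: "C = {X \<in> red c. \<forall>Y\<in>C. X \<subseteq> Y \<or> Y \<subseteq> X}" using C unfolding maxchain_iff .
  have Cred: "C \<subseteq> red c" using Ceq by blast
  have CA: "T \<subseteq> A" if "T \<in> C" for T using that Cred red_subset_supp[of c] bc(3) by blast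
  have SB: "S \<subseteq> B" using S mins_subset_supp[of d] bd(3) by blast
  have "X \<in> (\<lambda>T. T \<union> S) ` C"
    if X: "X \<in> red ?h" "\<And>T. T \<in> C \<Longrightarrow> X \<subseteq> T \<union> S \<or> T \<union> S \<subseteq> X" for X
  proof -
    note cases = red_tensor_cases[OF disj bc(3) bd(3) X(1)]
    then have XAB: "X = (X \<inter> A) \<union> (X \<inter> B)" by blast
    have cmp: "X \<inter> A \<subseteq> T \<and> X \<inter> B \<subseteq> S \<or> T \<subseteq> X \<inter> A \<and> S \<subseteq> X \<inter> B" if "T \<in> C" for T
      using X(2)[OF that] CA[OF that] SB disj by blast
    \<comment> \<open>The instance at \<open>{}\<close> excludes the empty chain as well.\<close>
    obtain T0 where T0: "T0 \<in> C" using nsing[of "{}"] by blast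
    have mS: "X \<inter> B = S" if "X \<inter> B \<subseteq> S"
      using minsD[OF S _ that] cases mins_subset_supp[of d] red_subset_supp[of d] by blast
    have "X \<inter> B = S"
    proof (rule ccontr)
      assume neq: "X \<inter> B \<noteq> S"
      then have up: "T \<subseteq> X \<inter> A \<and> S \<subseteq> X \<inter> B" if "T \<in> C" for T using cmp[OF that] mS by blast
      have "X \<inter> B \<notin> mins d"
      proof
        assume "X \<inter> B \<in> mins d"
        then have "S = X \<inter> B" using minsD[of "X \<inter> B" d S] S mins_subset_supp[of d] up[OF T0] by blast
        then show False using neq by simp
      qed
      then have "X \<inter> A \<in> mins c" using cases by blast
      then have "T = X \<inter> A" if "T \<in> C" for T
        using minsD[of "X \<inter> A" c T] up[OF that] that Cred red_subset_supp[of c] by blast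
      then have "C \<subseteq> {X \<inter> A}" by blast
      then show False using nsing by blast
    qed
    moreover have "X \<inter> A \<in> C"
    proof -
      have "X \<inter> A \<in> red c" using cases mins_subset_red[of c] by blast
      moreover have "\<forall>T\<in>C. X \<inter> A \<subseteq> T \<or> T \<subseteq> X \<inter> A" using cmp by blast
      ultimately show ?thesis by (subst Ceq) simp
    qed
    ultimately show ?thesis using XAB by blast
  qed
  moreover have "T \<union> S \<in> red ?h" if "T \<in> C" for T
    using red_tensor_sufficient[OF disj bc(3) bd(3) _ S] that Cred by blast
  moreover have "T \<union> S \<subseteq> T' \<union> S \<or> T' \<union> S \<subseteq> T \<union> S" if "T \<in> C" "T' \<in> C" for T T'
    using Ceq that by blast
  ultimately show ?thesis
    unfolding maxchain_iff by (intro equalityI subsetI) (simp_all del: Un_subset_iff, blast+)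
qed

text \<open>Fixing one minimal element in each factor gives two families of maximal chains of the
  product. A common member would have the fixed \<open>T\<close> as its only \<open>A\<close>-part,
  so its preimage in the first factor would be contained in \<open>{T}\<close>.\<close>

lemma card_maxchains_tensor:
  assumes c: "type_coef A c" and d: "type_coef B d" and disj: "A \<inter> B = {}"
    and ne: "\<And>T. c \<noteq> single T" "\<And>T. d \<noteq> single T"
  shows "card {C. subset.maxchain (red c) C} + card {C. subset.maxchain (red d) C}
    \<le> card {C. subset.maxchain (red (tensor_coef A B c d)) C}"
proof -
  let ?h = "tensor_coef A B c d"
  let ?C = "{C. subset.maxchain (red c) C}" and ?D = "{C. subset.maxchain (red d) C}"
  let ?H = "{C. subset.maxchain (red ?h) C}"
  note bc = type_coef_basics[OF c] and bd = type_coef_basics[OF d]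
  note bh = type_coef_basics[OF type_coef.tensor[OF c d disj]]
  have fin: "finite (red c)" "finite (red d)" "finite (red ?h)"
    using finite_supp[OF bc(3,1)] finite_supp[OF bd(3,1)] finite_supp[OF bh(3,1)]
      red_subset_supp finite_subset by metis+
  obtain T where T: "T \<in> mins c" "T \<subseteq> A"
    using ex_mins[OF c] by blast
  obtain S where S: "S \<in> mins d" "S \<subseteq> B"
    using ex_mins[OF d] by blast
  have redA: "red c \<subseteq> Pow A" "red d \<subseteq> Pow B"
    using red_subset_supp[of c] red_subset_supp[of d] bc(3) bd(3) by blast+
  have inj: "inj_on ((`) (\<lambda>T. T \<union> S)) ?C" "inj_on ((`) (\<lambda>S. S \<union> T)) ?D"
    by (rule inj_on_maxchains; rule inj_onI; use redA T S disj in blast)+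
  let ?CS = "(`) (\<lambda>T. T \<union> S) ` ?C" and ?TD = "(`) (\<lambda>S. S \<union> T) ` ?D"
  have "?CS \<subseteq> ?H"
    using maxchain_tensor[OF c d disj _ _ S(1)] maxchain_not_singleton[OF c _ ne(1)] by blast
  moreover have "?TD \<subseteq> ?H"
  proof -
    have "B \<inter> A = {}" using disj by blast
    then show ?thesis
      using maxchain_tensor[OF d c _ _ _ T(1)] maxchain_not_singleton[OF d _ ne(2)]
      by (subst tensor_coef_commute) blast
  qed
  moreover have "?CS \<inter> ?TD = {}"
  proof (rule ccontr)
    assume "?CS \<inter> ?TD \<noteq> {}"
    then obtain C D where CD: "subset.maxchain (red c) C" "subset.maxchain (red d) D"
      "(\<lambda>T. T \<union> S) ` C = (\<lambda>S. S \<union> T) ` D" by blast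
    have "C \<subseteq> red c" "D \<subseteq> red d" using CD(1,2) by (simp_all add: subset.maxchain_def subset_chain_def)
    have "X = T" if X: "X \<in> C" for X
    proof -
      obtain Y where "Y \<in> D" "X \<union> S = Y \<union> T" using CD(3) X by blast
      moreover have "X \<subseteq> A" "Y \<subseteq> B"
        using \<open>Y \<in> D\<close> X \<open>C \<subseteq> red c\<close> \<open>D \<subseteq> red d\<close> redA by blast+
      ultimately show ?thesis using T(2) S(2) disj by blast
    qed
    then have "C \<subseteq> {T}" by blast
    then show False using maxchain_not_singleton[OF c CD(1) ne(1)] by blast
  qed
  ultimately have "card ?CS + card ?TD \<le> card ?H"
    using card_Un_disjoint[of ?CS ?TD] card_mono[of ?H "?CS \<union> ?TD"] finite_maxchains[OF fin(3)]
      finite_subset[of _ ?H] by (metis Un_least)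
  then show ?thesis using card_image[OF inj(1)] card_image[OF inj(2)] by simp
qed

text \<open>The poset of \<open>single T\<close> is just \<open>{T}\<close>, so the reduced poset of
  the product is that of \<open>d\<close> with \<open>T\<close> added to every element.\<close>

lemma card_maxchains_tensor_single:
  assumes d: "type_coef B d" and disj: "A \<inter> B = {}" and T: "T \<subseteq> A"
  shows "card {C. subset.maxchain (red d) C}
    \<le> card {C. subset.maxchain (red (tensor_coef A B (single T) d)) C}"
proof -
  note bd = type_coef_basics[OF d]
  have sT: "supp (single T) \<subseteq> Pow A" using T by (simp add: supp_single)
  have redB: "red d \<subseteq> Pow B" using red_subset_supp[of d] bd(3) by blast
  have eq: "red (tensor_coef A B (single T) d) = (\<lambda>S. T \<union> S) ` red d"
  proof (intro equalityI subsetI)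
    fix X assume "X \<in> red (tensor_coef A B (single T) d)"
    then have "X \<subseteq> A \<union> B" "X \<inter> A = T" "X \<inter> B \<in> red d"
      using red_tensor_cases[OF disj sT bd(3), of X] mins_subset_red[of d]
      by (auto simp: red_single mins_single)
    then show "X \<in> (\<lambda>S. T \<union> S) ` red d" by blast
  next
    fix X assume "X \<in> (\<lambda>S. T \<union> S) ` red d"
    then show "X \<in> red (tensor_coef A B (single T) d)"
      using red_tensor_sufficient'[OF disj sT bd(3), of T] by (auto simp: mins_single)
  qed
  have "finite (red d)" using finite_supp[OF bd(3,1)] red_subset_supp[of d] finite_subset by blast
  then show ?thesis
    unfolding eq by (rule card_maxchains_image_le) (use redB T disj in blast)
qed

subsection \<open>Chain types\<close>

primrec alt :: "'a set list \<Rightarrow> 'a set \<Rightarrow> real" where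
  "alt [] = (\<lambda>T. 0)"
| "alt (S # L) = (\<lambda>T. single S T - alt L T)"

text \<open>The flag is the parity of the length: \<open>False\<close> gives the chain types, with
  an odd number of members, while \<open>True\<close> occurs in between, when a member is added or
  removed at one end.\<close>

definition chain_coef :: "'a set \<Rightarrow> bool \<Rightarrow> ('a set \<Rightarrow> real) \<Rightarrow> bool" where
  "chain_coef A p c \<longleftrightarrow>
    (\<exists>L. sorted_wrt (\<subset>) L \<and> set L \<subseteq> Pow A \<and> even (length L) = p \<and> c = alt L)"

lemma alt_append: "alt (L @ [S]) T = alt L T + (-1) ^ length L * single S T"
  by (induction L) (auto simp: algebra_simps)

lemma alt_eq_0: "T \<notin> set L \<Longrightarrow> alt L T = 0"
  by (induction L) (auto simp: single_def)

lemma chain_coef_mono: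
  assumes "chain_coef A p c" "A \<subseteq> B"
  shows "chain_coef B p c"
proof -
  obtain L where "sorted_wrt (\<subset>) L" "set L \<subseteq> Pow A" "even (length L) = p" "c = alt L"
    using assms(1) unfolding chain_coef_def by blast
  then show ?thesis using assms(2) unfolding chain_coef_def by (intro exI[of _ L]) auto
qed

lemma chain_coef_single: "T \<subseteq> A \<Longrightarrow> chain_coef A False (single T)"
  unfolding chain_coef_def by (intro exI[of _ "[T]"]) auto

text \<open>If \<open>B\<close> is already the last member of the chain, the two terms cancel.\<close>

lemma chain_coef_append:
  assumes "chain_coef B p c"
  shows "chain_coef B (\<not> p) (\<lambda>T. c T + (if p then 1 else -1) * single B T)"
proof -
  obtain L where L: "sorted_wrt (\<subset>) L" "set L \<subseteq> Pow B" "even (length L) = p" "c = alt L"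
    using assms unfolding chain_coef_def by blast
  show ?thesis
  proof (cases "B \<in> set L")
    case True
    then obtain R S where R: "L = R @ [S]" by (cases L rule: rev_cases) auto
    have "\<forall>U\<in>set R. U \<subset> S" using L(1) by (simp add: R sorted_wrt_append)
    then have "B = S" using True L(2) R by auto
    then have "(\<lambda>T. c T + (if p then 1 else -1) * single B T) = alt R"
      using L(3,4) R by (auto simp: alt_append fun_eq_iff)
    then show ?thesis
      using L R unfolding chain_coef_def by (intro exI[of _ R]) (auto simp: sorted_wrt_append)
  next
    case False
    then have "\<forall>U\<in>set L. U \<subset> B" using L(2) by auto
    then have "sorted_wrt (\<subset>) (L @ [B])" using L(1) by (simp add: sorted_wrt_append)
    moreover have "(\<lambda>T. c T + (if p then 1 else -1) * single B T) = alt (L @ [B])"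
      using L(3,4) by (auto simp: alt_append fun_eq_iff)
    ultimately show ?thesis
      using L unfolding chain_coef_def by (intro exI[of _ "L @ [B]"]) auto
  qed
qed

text \<open>Subtraction from \<open>single {}\<close> shifts all signs by one place. If
  \<open>{}\<close> already heads the chain it cancels and the tail remains.\<close>

lemma chain_coef_prepend:
  assumes "chain_coef A p c"
  shows "chain_coef A (\<not> p) (\<lambda>T. single {} T - c T)"
proof -
  obtain L where L: "sorted_wrt (\<subset>) L" "set L \<subseteq> Pow A" "even (length L) = p" "c = alt L"
    using assms unfolding chain_coef_def by blast
  show ?thesis
  proof (cases "{} \<in> set L")
    case True
    then obtain R S where R: "L = S # R" by (cases L) auto
    then have "S = {}" using L(1) True by auto
    then show ?thesis
      using L R unfolding chain_coef_def by (intro exI[of _ R]) auto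
  next
    case False
    then have "\<forall>U\<in>set L. {} \<subset> U" by auto
    then show ?thesis
      using L unfolding chain_coef_def by (intro exI[of _ "{} # L"]) auto
  qed
qed

text \<open>Star is 1 - (f - p_A): one change at the top of the chain followed by one at the bottom,
  so the parity flips twice.\<close>

lemma chain_coef_star:
  assumes "chain_coef A False c"
  shows "chain_coef A False (star_coef A c)"
proof -
  have "chain_coef A (\<not> (\<not> False)) (\<lambda>T. single {} T - (c T + (if False then 1 else -1) * single A T))"
    by (intro chain_coef_prepend chain_coef_append assms)
  moreover have "(\<lambda>T. single {} T - (c T + (if False then 1 else -1) * single A T)) = star_coef A c"
    by (auto simp: star_coef_def)
  ultimately show ?thesis by simp
qed

text \<open>This is $f \lhd p_P^* = f \otimes 1 + p_A \otimes (p_P^* - 1)$.\<close>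

definition series_coef :: "'a set \<Rightarrow> 'a set \<Rightarrow> 'a set \<Rightarrow> ('a set \<Rightarrow> real) \<Rightarrow> 'a set \<Rightarrow> real" where
  "series_coef A B P c = (\<lambda>S. c S - single (A \<union> P) S + single (A \<union> B) S)"

text \<open>All members lie in \<open>A\<close>, so first \<open>A \<union> P\<close> and then
  \<open>A \<union> B\<close> can be appended, with alternating signs.\<close>

lemma chain_coef_series:
  assumes "chain_coef A False c" "P \<subseteq> B"
  shows "chain_coef (A \<union> B) False (series_coef A B P c)"
proof -
  have "chain_coef (A \<union> P) False c" by (rule chain_coef_mono[OF assms(1)]) simp
  then have "chain_coef (A \<union> P) True (\<lambda>T. c T - single (A \<union> P) T)"
    using chain_coef_append[of "A \<union> P" False c] by simp
  then have "chain_coef (A \<union> B) True (\<lambda>T. c T - single (A \<union> P) T)"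
    by (rule chain_coef_mono) (use assms(2) in blast)
  then show ?thesis using chain_coef_append[of "A \<union> B" True] by (simp add: series_coef_def)
qed

text \<open>Each member \<open>S\<close> becomes \<open>T \<union> S\<close>; as \<open>T\<close> is
  disjoint from all members, inclusions stay strict.\<close>

lemma chain_coef_tensor_single:
  assumes c: "chain_coef B False c" and disj: "A \<inter> B = {}" and T: "T \<subseteq> A"
  shows "chain_coef (A \<union> B) False (tensor_coef A B (single T) c)"
proof -
  obtain L where L: "sorted_wrt (\<subset>) L" "set L \<subseteq> Pow B" "odd (length L)" "c = alt L"
    using c unfolding chain_coef_def by auto
  have "alt (map (\<lambda>S. T \<union> S) L) X = tensor_coef A B (single T) (alt L) X"
    if "set L \<subseteq> Pow B" for L X
    using that
  proof (induction L)
    case Nil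
    then show ?case by (simp add: tensor_coef_def)
  next
    case (Cons S L)
    then have "X = T \<union> S \<longleftrightarrow> X \<subseteq> A \<union> B \<and> X \<inter> A = T \<and> X \<inter> B = S"
      using T disj by (simp; blast)
    then show ?case using Cons by (auto simp: tensor_coef_def single_def)
  qed
  moreover have "sorted_wrt (\<subset>) (map (\<lambda>S. T \<union> S) L)"
    unfolding sorted_wrt_map
  proof (rule sorted_wrt_mono_rel[OF _ L(1)])
    fix S S' assume "S \<in> set L" "S' \<in> set L" "S \<subset> S'"
    then show "T \<union> S \<subset> T \<union> S'" using L(2) T disj by blast
  qed
  moreover have "set (map (\<lambda>S. T \<union> S) L) \<subseteq> Pow (A \<union> B)" using L(2) T by auto
  ultimately show ?thesis
    unfolding chain_coef_def using L(2-4) by (intro exI[of _ "map (\<lambda>S. T \<union> S) L"]) auto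
qed

section \<open>Alternating sums over chains are type functions\<close>

lemma type_coef_const: "finite A \<Longrightarrow> A \<noteq> {} \<Longrightarrow> type_coef A (single {})"
proof (induction A rule: finite_ne_induct)
  case (singleton a)
  show ?case by (rule type_coef.one)
next
  case (insert a A)
  then have "type_coef ({a} \<union> A) (tensor_coef {a} A (single {}) (single {}))"
    by (intro type_coef.tensor type_coef.one) auto
  moreover have "tensor_coef {a} A (single {}) (single {}) = single {}"
    by (auto simp: tensor_coef_def single_def fun_eq_iff)
  ultimately show ?case by simp
qed

lemma type_coef_top: "finite A \<Longrightarrow> A \<noteq> {} \<Longrightarrow> type_coef A (single A)"
  using type_coef.star[OF type_coef_const, of A] by (simp add: star_coef_def)

text \<open>Tensoring with the constant 1 adds labels on which the function does not depend. The
  case of no added labels is separate because label sets of type functions are nonempty.\<close>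

lemma type_coef_extend:
  assumes c: "type_coef B c" and "finite A" "A \<inter> B = {}"
  shows "type_coef (A \<union> B) c"
proof (cases "A = {}")
  case False
  then have "type_coef (A \<union> B) (tensor_coef A B (single {}) c)"
    using assms by (intro type_coef.tensor type_coef_const)
  moreover have "tensor_coef A B (single {}) c = c"
  proof
    fix S
    show "tensor_coef A B (single {}) c S = c S"
    proof (cases "S \<subseteq> B")
      case True
      then have "S \<inter> A = {}" "S \<inter> B = S" using assms(3) by auto
      then show ?thesis using True by (auto simp: tensor_coef_def single_def)
    next
      case False
      then have "c S = 0" using type_coef_basics(3)[OF c] by (auto simp: supp_def)
      moreover have "S \<inter> A \<noteq> {}" if "S \<subseteq> A \<union> B" using that False by auto
      ultimately show ?thesis by (simp add: tensor_coef_def single_def)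
    qed
  qed
  ultimately show ?thesis by simp
qed (use c in simp)

lemma type_coef_tensor_top:
  assumes c: "type_coef B c" and "finite A" "A \<inter> B = {}"
  shows "type_coef (A \<union> B) (tensor_coef A B (single A) c)"
proof (cases "A = {}")
  case True
  have "tensor_coef {} B (single {}) c = c"
    using type_coef_basics(3)[OF c]
    by (auto simp: tensor_coef_def single_def supp_def fun_eq_iff Int_absorb2)
  then show ?thesis using c True by simp
qed (use assms in \<open>intro type_coef.tensor type_coef_top\<close>)

text \<open>p_T is the star of the constant 1 on the labels \<open>T\<close>, extended to the
  remaining labels of \<open>A\<close>.\<close>

lemma type_coef_single:
  assumes "finite A" "A \<noteq> {}" "T \<subseteq> A"
  shows "type_coef A (single T)"
proof (cases "T = {}")
  case False
  then have "type_coef ((A - T) \<union> T) (single T)"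
    using assms finite_subset by (intro type_coef_extend type_coef_top) auto
  moreover have "(A - T) \<union> T = A" using assms(3) by blast
  ultimately show ?thesis by simp
qed (use assms type_coef_const in simp)

text \<open>The two extreme members of a chain are split off by tensoring with \<open>single\<close> functions;
  what remains is, up to \<open>star_coef\<close>, an alternating sum over the inner members.\<close>

lemma type_coef_alt:
  assumes "finite A" "A \<noteq> {}" "X \<inter> A = {}" "sorted_wrt (\<subset>) L" "odd (length L)"
    and "\<And>S. S \<in> set L \<Longrightarrow> X \<subseteq> S \<and> S \<subseteq> X \<union> A"
  shows "type_coef A (\<lambda>T. if T \<subseteq> A then alt L (T \<union> X) else 0)"
  using assms
proof (induction "length L" arbitrary: L A X rule: less_induct)
  case less
  note prems = less.prems
  obtain S0 K where K: "L = S0 # K" using prems(5) by (cases L) auto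
  show ?case
  proof (cases "K = []")
    case True
    have "(\<lambda>T. if T \<subseteq> A then alt L (T \<union> X) else 0) = single (S0 - X)"
    proof
      fix T
      have "T \<subseteq> A \<and> T \<union> X = S0 \<longleftrightarrow> T = S0 - X" using prems(3) prems(6)[of S0] K by auto
      then show "(if T \<subseteq> A then alt L (T \<union> X) else 0) = single (S0 - X) T"
        using K True by (auto simp: single_def)
    qed
    moreover have "S0 - X \<subseteq> A" using prems(6)[of S0] K by auto
    ultimately show ?thesis using type_coef_single prems(1,2) by metis
  next
    case False
    then obtain M S1 where M: "K = M @ [S1]" by (cases K rule: rev_cases) auto
    have L: "L = S0 # M @ [S1]" using K M by simp
    have S01: "S0 \<subset> S1" and inner: "\<And>S. S \<in> set M \<Longrightarrow> S0 \<subset> S \<and> S \<subset> S1" and sM: "sorted_wrt (\<subset>) M"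
      using prems(4) unfolding L by (auto simp: sorted_wrt_append)
    have X: "X \<subseteq> S0" "S1 \<subseteq> X \<union> A" using prems(6)[of S0] prems(6)[of S1] L by auto
    have odd: "odd (length M)" using prems(5) L by simp
    \<comment> \<open>\<open>X\<close> collects the labels split off so far. The labels
      \<open>D\<close> are common to all members and give the factor \<open>single D\<close>; those
      outside \<open>S1\<close> occur in no member and are added by \<open>type_coef_extend\<close>;
      the inner chain lives on \<open>A'\<close>, relative to \<open>S0\<close>.\<close>
    define D A' where "D = S0 - X" and "A' = S1 - S0"
    let ?c = "\<lambda>T. if T \<subseteq> A' then alt M (T \<union> S0) else 0"
    have subs: "D \<subseteq> A" "A' \<subseteq> A" using X S01 unfolding D_def A'_def by auto
    have fin: "finite D" "finite A'" using subs prems(1) finite_subset by blast+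
    have "type_coef A' ?c"
    proof (rule less.hyps)
      show "length M < length L" using L by simp
      show "A' \<noteq> {}" "S0 \<inter> A' = {}" using S01 unfolding A'_def by auto
      show "S0 \<subseteq> S \<and> S \<subseteq> S0 \<union> A'" if "S \<in> set M" for S using inner[OF that] unfolding A'_def by auto
    qed (use fin sM odd in auto)
    then have "type_coef ((A - (D \<union> A')) \<union> (D \<union> A')) (tensor_coef D A' (single D) (star_coef A' ?c))"
      using prems(1) fin by (intro type_coef_extend type_coef_tensor_top type_coef.star)
        (auto simp: D_def A'_def)
    moreover have "(A - (D \<union> A')) \<union> (D \<union> A') = A" using subs by blast
    moreover have "tensor_coef D A' (single D) (star_coef A' ?c) =
        (\<lambda>T. if T \<subseteq> A then alt L (T \<union> X) else 0)"
    proof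
      fix T
      \<comment> \<open>Relative to \<open>S0\<close>, the sets \<open>S0\<close> and
        \<open>S1\<close> correspond to \<open>{}\<close> and \<open>A'\<close>, so this is the
        shape of \<open>star_coef A'\<close>.\<close>
      have altL: "alt L U = single S0 U + single S1 U - alt M U" for U
        using odd by (simp add: L alt_append)
      show "tensor_coef D A' (single D) (star_coef A' ?c) T = (if T \<subseteq> A then alt L (T \<union> X) else 0)"
      proof (cases "T \<subseteq> D \<union> A' \<and> D \<subseteq> T")
        case True
        then have eq: "T \<union> X = (T \<inter> A') \<union> S0" and TD: "T \<inter> D = D" using X unfolding D_def A'_def by auto
        have "T \<union> X = S0 \<longleftrightarrow> T \<inter> A' = {}" "T \<union> X = S1 \<longleftrightarrow> T \<inter> A' = A'"
          unfolding eq using S01 unfolding A'_def by auto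
        then show ?thesis
          using True subs TD by (auto simp: tensor_coef_def star_coef_def altL eq[symmetric] single_def)
      next
        case False
        \<comment> \<open>Every member of the chain lies between \<open>S0\<close> and
          \<open>S1\<close>, hence no member equals \<open>T \<union> X\<close>.\<close>
        have "\<not> (S0 \<subseteq> T \<union> X \<and> T \<union> X \<subseteq> S1)" if "T \<subseteq> A"
          using False that prems(3) X unfolding D_def A'_def by blast
        then have "alt L (T \<union> X) = 0" if "T \<subseteq> A"
          using that inner S01 unfolding L by (intro alt_eq_0) auto
        moreover have "tensor_coef D A' (single D) (star_coef A' ?c) T = 0"
          using False by (auto simp: tensor_coef_def single_def)
        ultimately show ?thesis by simp
      qed
    qed
    ultimately show ?thesis by simp
  qed
qed

lemma type_coef_chain:
  assumes "chain_coef A False c" "finite A" "A \<noteq> {}"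
  shows "type_coef A c"
proof -
  obtain L where L: "sorted_wrt (\<subset>) L" "set L \<subseteq> Pow A" "odd (length L)" "c = alt L"
    using assms(1) unfolding chain_coef_def by auto
  have "type_coef A (\<lambda>T. if T \<subseteq> A then alt L (T \<union> {}) else 0)"
    using assms(2,3) L by (intro type_coef_alt) auto
  moreover have "alt L T = 0" if "\<not> T \<subseteq> A" for T using that L(2) by (intro alt_eq_0) auto
  then have "(\<lambda>T. if T \<subseteq> A then alt L (T \<union> {}) else 0) = c" using L(4) by (auto simp: fun_eq_iff)
  ultimately show ?thesis by simp
qed

text \<open>\<open>A \<subseteq> T\<close> says that the first string is zero; there
  \<open>zeta c A = 1\<close> leaves exactly the value of the star of p_P on the second string.
  Otherwise both correction terms vanish.\<close>

lemma zeta_series: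
  assumes "finite A" "finite B" "A \<inter> B = {}" "P \<subseteq> B" "T \<subseteq> A \<union> B" "supp c \<subseteq> Pow A" "zeta c A = 1"
  shows "zeta (series_coef A B P c) T =
    (if A \<subseteq> T then 1 - of_bool (P \<subseteq> T) + of_bool (B \<subseteq> T) else zeta c (T \<inter> A))"
proof -
  have "finite T" using assms finite_subset by blast
  then have "zeta (series_coef A B P c) T = zeta c (T \<inter> A) - of_bool (A \<union> P \<subseteq> T) + of_bool (A \<union> B \<subseteq> T)"
    using zeta_supp[OF assms(6), of T] by (simp add: series_coef_def zeta_add zeta_diff zeta_single)
  moreover have "T \<inter> A = A" if "A \<subseteq> T" using that by blast
  ultimately show ?thesis using assms(7) by auto
qed

text \<open>For \<open>j\<close> in \<open>A\<close> the first string is nonzero and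
  \<open>c\<close> decides; for \<open>j\<close> in \<open>B\<close> it is zero, and the star of p_P
  has the outputs \<open>P\<close>.\<close>

lemma outs_series:
  assumes "finite A" "finite B" "A \<inter> B = {}" "P \<subseteq> B" "supp c \<subseteq> Pow A" "zeta c A = 1"
  shows "outs (A \<union> B) (series_coef A B P c) = outs A c \<union> P"
proof (rule set_eqI)
  fix j
  have "(A \<union> B - {j}) \<inter> A = A - {j}" using assms(3) by blast
  then have z: "zeta (series_coef A B P c) (A \<union> B - {j}) =
    (if A \<subseteq> A \<union> B - {j} then 1 - of_bool (P \<subseteq> A \<union> B - {j}) + of_bool (B \<subseteq> A \<union> B - {j}) else zeta c (A - {j}))"
    using zeta_series[OF assms(1-4), of "A \<union> B - {j}"] assms(5,6) by auto
  consider "j \<in> A" "j \<notin> B" | "j \<in> B" "j \<notin> A" | "j \<notin> A" "j \<notin> B" using assms(3) by blast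
  then show "j \<in> outs (A \<union> B) (series_coef A B P c) \<longleftrightarrow> j \<in> outs A c \<union> P"
  proof cases
    case 1
    then have "\<not> A \<subseteq> A \<union> B - {j}" "j \<notin> P" using assms(4) by auto
    then show ?thesis using 1 z by (simp add: outs_def)
  next
    case 2
    then have "A \<subseteq> A \<union> B - {j}" "\<not> B \<subseteq> A \<union> B - {j}" "P \<subseteq> A \<union> B - {j} \<longleftrightarrow> j \<notin> P" using assms(4) by auto
    then show ?thesis using 2 z by (simp add: outs_def)
  next
    case 3
    then show ?thesis using assms(4) by (auto simp: outs_def)
  qed
qed

subsection \<open>Normal forms\<close>

lemma finite_leaves: "finite (leaves e)"
  by (induction e) auto

lemma eval_expr_cong:
  "(\<And>x. x \<in> leaves e \<Longrightarrow> h x = k x) \<Longrightarrow>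
    eval_expr (map_lattice_expr h e) = eval_expr (map_lattice_expr k e)"
  by (metis lattice_expr.map_cong)

lemma eval_expr_const:
  fixes k :: "'b::lattice"
  shows "(\<And>x. x \<in> leaves e \<Longrightarrow> h x = k) \<Longrightarrow> eval_expr (map_lattice_expr h e) = k"
  by (induction e) auto

primrec dual_expr :: "'a lattice_expr \<Rightarrow> 'a lattice_expr" where
  "dual_expr (Leaf x) = Leaf x"
| "dual_expr (Join a b) = Meet (dual_expr a) (dual_expr b)"
| "dual_expr (Meet a b) = Join (dual_expr a) (dual_expr b)"

lemma leaves_dual [simp]: "leaves (dual_expr e) = leaves e"
  by (induction e) auto

text \<open>De Morgan for maximum and minimum under x to 1 - x.\<close>

lemma eval_dual:
  fixes h :: "'a \<Rightarrow> real"
  shows "eval_expr (map_lattice_expr (\<lambda>x. 1 - h x) (dual_expr e)) = 1 - eval_expr (map_lattice_expr h e)"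
  by (induction e) (auto simp: sup_max inf_min max_def min_def)

text \<open>The leaves are coefficient functions, on which pointwise maximum and minimum would be
  meaningless; the expression is therefore evaluated on their values at each set of zeros.\<close>

definition represents :: "'a set \<Rightarrow> ('a set \<Rightarrow> real) \<Rightarrow> ('a set \<Rightarrow> real) lattice_expr \<Rightarrow> bool" where
  "represents A c e \<longleftrightarrow>
    (\<forall>g\<in>leaves e. chain_coef A False g \<and> outs A g = outs A c) \<and>
    (\<forall>T\<subseteq>A. eval_expr (map_lattice_expr (\<lambda>g. zeta g T) e) = zeta c T)"

lemma representsD:
  assumes "represents A c e"
  shows "g \<in> leaves e \<Longrightarrow> chain_coef A False g" "g \<in> leaves e \<Longrightarrow> outs A g = outs A c"
    "T \<subseteq> A \<Longrightarrow> eval_expr (map_lattice_expr (\<lambda>g. zeta g T) e) = zeta c T"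
  using assms unfolding represents_def by blast+

text \<open>Away from the zero string, star is the complement, which dualises the expression. Equal
  outputs persist because leaves, being type functions, take only the values 0 and 1.\<close>

lemma represents_star:
  assumes c: "type_coef A c" and e: "represents A c e"
  shows "represents A (star_coef A c) (map_lattice_expr (star_coef A) (dual_expr e))"
  unfolding represents_def
proof (intro conjI ballI allI impI)
  note b = type_coef_basics[OF c] and r = representsD[OF e]
  have leaf: "type_coef A g" if "g \<in> leaves e" for g using type_coef_chain[OF r(1)[OF that] b(1,2)] .
  fix g assume "g \<in> leaves (map_lattice_expr (star_coef A) (dual_expr e))"
  then obtain h where h: "h \<in> leaves e" "g = star_coef A h" by (auto simp: lattice_expr.set_map)
  show "chain_coef A False g" using chain_coef_star r(1) h by blast
  have "zeta h (A - {j}) = 0 \<longleftrightarrow> zeta c (A - {j}) = 0" if "j \<in> A" for j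
  proof -
    have "j \<in> outs A h \<longleftrightarrow> j \<in> outs A c" using r(2)[OF h(1)] by simp
    then have "zeta h (A - {j}) = 1 \<longleftrightarrow> zeta c (A - {j}) = 1" using that by (simp add: outs_def)
    then show ?thesis
      using b(5)[of "A - {j}"] type_coef_basics(5)[OF leaf[OF h(1)], of "A - {j}"] by auto
  qed
  then show "outs A g = outs A (star_coef A c)" by (auto simp: h(2) outs_star b(1))
next
  note b = type_coef_basics[OF c] and r = representsD[OF e]
  fix T assume T: "T \<subseteq> A"
  have "type_coef A g" if "g \<in> leaves e" for g using type_coef_chain[OF r(1)[OF that] b(1,2)] .
  note leaf = type_coef_basics[OF this]
  have *: "eval_expr (map_lattice_expr (\<lambda>g. zeta g T) (map_lattice_expr (star_coef A) (dual_expr e))) =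
      eval_expr (map_lattice_expr (\<lambda>g. zeta (star_coef A g) T) (dual_expr e))"
    by (simp add: lattice_expr.map_comp comp_def)
  show "eval_expr (map_lattice_expr (\<lambda>g. zeta g T) (map_lattice_expr (star_coef A) (dual_expr e))) =
      zeta (star_coef A c) T"
  proof (cases "T = A")
    \<comment> \<open>At the zero string star does not complement: all leaves and the result take
      the value 1.\<close>
    case True
    then show ?thesis unfolding * using b(1,4) leaf(4)
      by (subst eval_expr_const[of _ _ 1]) (auto simp: zeta_star)
  next
    case False
    have "eval_expr (map_lattice_expr (\<lambda>g. zeta (star_coef A g) T) (dual_expr e)) =
        eval_expr (map_lattice_expr (\<lambda>g. 1 - zeta g T) (dual_expr e))"
      using False T b(1) by (intro eval_expr_cong) (simp add: zeta_star)
    then show ?thesis unfolding * using eval_dual[of "\<lambda>g. zeta g T" e] r(3)[OF T] False T b(1)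
      by (simp add: zeta_star)
  qed
qed

text \<open>At a fixed \<open>U\<close> the factor \<open>single T\<close> is 0 or 1; multiplication
  by it makes all leaves 0 or leaves their values unchanged.\<close>

lemma represents_tensor_single:
  assumes d: "type_coef B d" and e: "represents B d e" and disj: "A \<inter> B = {}" and T: "T \<subseteq> A"
    and A: "finite A" "A \<noteq> {}"
  shows "represents (A \<union> B) (tensor_coef A B (single T) d) (map_lattice_expr (tensor_coef A B (single T)) e)"
  unfolding represents_def
proof (intro conjI ballI allI impI)
  note b = type_coef_basics[OF d] and r = representsD[OF e]
  have leaf: "type_coef B g" if "g \<in> leaves e" for g using type_coef_chain[OF r(1)[OF that] b(1,2)] .
  have tT: "type_coef A (single T)" by (rule type_coef_single[OF A T])
  fix g assume "g \<in> leaves (map_lattice_expr (tensor_coef A B (single T)) e)"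
  then obtain h where h: "h \<in> leaves e" "g = tensor_coef A B (single T) h" by (auto simp: lattice_expr.set_map)
  show "chain_coef (A \<union> B) False g" using chain_coef_tensor_single[OF r(1)[OF h(1)] disj T] h(2) by simp
  show "outs (A \<union> B) g = outs (A \<union> B) (tensor_coef A B (single T) d)"
    using outs_tensor[OF tT leaf[OF h(1)] disj] outs_tensor[OF tT d disj] r(2)[OF h(1)] h(2) by simp
next
  note b = type_coef_basics[OF d] and r = representsD[OF e]
  fix U assume U: "U \<subseteq> A \<union> B"
  let ?k = "zeta (single T) (U \<inter> A)"
  have z: "zeta (tensor_coef A B (single T) g) U = ?k * zeta g (U \<inter> B)" for g
    by (rule zeta_tensor[OF A(1) b(1) disj U])
  have *: "eval_expr (map_lattice_expr (\<lambda>g. zeta g U) (map_lattice_expr (tensor_coef A B (single T)) e)) =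
      eval_expr (map_lattice_expr (\<lambda>g. ?k * zeta g (U \<inter> B)) e)"
    by (simp add: lattice_expr.map_comp comp_def z)
  show "eval_expr (map_lattice_expr (\<lambda>g. zeta g U) (map_lattice_expr (tensor_coef A B (single T)) e)) =
      zeta (tensor_coef A B (single T) d) U"
  proof (cases "?k = 0")
    case True
    then show ?thesis unfolding * z by (subst eval_expr_const[of _ _ 0]) auto
  next
    case False
    then have "?k = 1" using zeta_single[of "U \<inter> A" T] A(1) by auto
    then show ?thesis unfolding * z using r(3)[of "U \<inter> B"] by simp
  qed
qed

text \<open>Each series composition extends the leaves of one factor by the outputs of the other, so
  every new leaf has the outputs of the product. The meet is correct by the upper bound in
  \<open>type_coef_bounds\<close>.\<close>

lemma represents_tensor:
  assumes c: "type_coef A c" "represents A c e" and d: "type_coef B d" "represents B d e'"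
    and disj: "A \<inter> B = {}"
  shows "represents (A \<union> B) (tensor_coef A B c d)
    (Meet (map_lattice_expr (series_coef A B (outs B d)) e)
      (map_lattice_expr (series_coef B A (outs A c)) e'))"
  unfolding represents_def
proof (intro conjI ballI allI impI)
  note bc = type_coef_basics[OF c(1)] and rc = representsD[OF c(2)]
  note bd = type_coef_basics[OF d(1)] and rd = representsD[OF d(2)]
  have lc: "type_coef A g" if "g \<in> leaves e" for g using type_coef_chain[OF rc(1)[OF that] bc(1,2)] .
  have ld: "type_coef B g" if "g \<in> leaves e'" for g using type_coef_chain[OF rd(1)[OF that] bd(1,2)] .
  have outs: "outs A c \<subseteq> A" "outs B d \<subseteq> B" by (auto simp: outs_def)
  have disj': "B \<inter> A = {}" using disj by blast
  {
    fix g assume "g \<in> leaves (Meet (map_lattice_expr (series_coef A B (outs B d)) e)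
      (map_lattice_expr (series_coef B A (outs A c)) e'))"
    then consider h where "h \<in> leaves e" "g = series_coef A B (outs B d) h"
      | h where "h \<in> leaves e'" "g = series_coef B A (outs A c) h"
      by (auto simp: lattice_expr.set_map)
    then show "chain_coef (A \<union> B) False g"
      "outs (A \<union> B) g = outs (A \<union> B) (tensor_coef A B c d)"
    proof (atomize (full), cases)
      case (1 h)
      note bh = type_coef_basics[OF lc[OF 1(1)]]
      show "chain_coef (A \<union> B) False g \<and> outs (A \<union> B) g = outs (A \<union> B) (tensor_coef A B c d)"
        using chain_coef_series[OF rc(1)[OF 1(1)] outs(2)] rc(2)[OF 1(1)]
          outs_series[OF bc(1) bd(1) disj outs(2) bh(3,4)] outs_tensor[OF c(1) d(1) disj]
        unfolding 1(2) by simp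
    next
      case (2 h)
      note bh = type_coef_basics[OF ld[OF 2(1)]]
      show "chain_coef (A \<union> B) False g \<and> outs (A \<union> B) g = outs (A \<union> B) (tensor_coef A B c d)"
        using chain_coef_series[OF rd(1)[OF 2(1)] outs(1)] rd(2)[OF 2(1)]
          outs_series[OF bd(1) bc(1) disj' outs(1) bh(3,4)] outs_tensor[OF c(1) d(1) disj]
        unfolding 2(2) by (simp add: Un_commute)
    qed
  }
  fix T assume T: "T \<subseteq> A \<union> B"
  then have T': "T \<subseteq> B \<union> A" by blast
  let ?kd = "1 - of_bool (outs B d \<subseteq> T) + of_bool (B \<subseteq> T) :: real"
  let ?kc = "1 - of_bool (outs A c \<subseteq> T) + of_bool (A \<subseteq> T) :: real"
  \<comment> \<open>If \<open>A \<subseteq> T\<close>, all leaves share the value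
    \<open>?kd\<close>; otherwise they keep their values at \<open>T \<inter> A\<close>.\<close>
  have 1: "eval_expr (map_lattice_expr (\<lambda>g. zeta (series_coef A B (outs B d) g) T) e) =
      (if A \<subseteq> T then ?kd else zeta c (T \<inter> A))"
  proof -
    have z: "zeta (series_coef A B (outs B d) g) T = (if A \<subseteq> T then ?kd else zeta g (T \<inter> A))" if "g \<in> leaves e" for g
      by (rule zeta_series[OF bc(1) bd(1) disj outs(2) T type_coef_basics(3,4)[OF lc[OF that]]])
    show ?thesis
    proof (cases "A \<subseteq> T")
      case True
      then show ?thesis using z by (subst eval_expr_const[of _ _ ?kd]) auto
    next
      case False
      then show ?thesis using z rc(3)[of "T \<inter> A"]
        by (subst eval_expr_cong[of _ _ "\<lambda>g. zeta g (T \<inter> A)"]) auto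
    qed
  qed
  have 2: "eval_expr (map_lattice_expr (\<lambda>g. zeta (series_coef B A (outs A c) g) T) e') =
      (if B \<subseteq> T then ?kc else zeta d (T \<inter> B))"
  proof -
    have z: "zeta (series_coef B A (outs A c) g) T = (if B \<subseteq> T then ?kc else zeta g (T \<inter> B))" if "g \<in> leaves e'" for g
      by (rule zeta_series[OF bd(1) bc(1) disj' outs(1) T' type_coef_basics(3,4)[OF ld[OF that]]])
    show ?thesis
    proof (cases "B \<subseteq> T")
      case True
      then show ?thesis using z by (subst eval_expr_const[of _ _ ?kc]) auto
    next
      case False
      then show ?thesis using z rd(3)[of "T \<inter> B"]
        by (subst eval_expr_cong[of _ _ "\<lambda>g. zeta g (T \<inter> B)"]) auto
    qed
  qed
  have zc: "zeta c (T \<inter> A) = 0 \<or> zeta c (T \<inter> A) = 1" and zd: "zeta d (T \<inter> B) = 0 \<or> zeta d (T \<inter> B) = 1"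
    using bc(5) bd(5) by auto
  have zA: "zeta c (T \<inter> A) = 1" if "A \<subseteq> T" using that bc(4) by (simp add: Int_absorb1)
  have zB: "zeta d (T \<inter> B) = 1" if "B \<subseteq> T" using that bd(4) by (simp add: Int_absorb1)
  have oA: "zeta c (T \<inter> A) = 0" if "\<not> A \<subseteq> T" "outs A c \<subseteq> T"
    using type_coef_bounds(2)[OF c(1), of "T \<inter> A"] that outs by auto
  have oB: "zeta d (T \<inter> B) = 0" if "\<not> B \<subseteq> T" "outs B d \<subseteq> T"
    using type_coef_bounds(2)[OF d(1), of "T \<inter> B"] that outs by auto
  have "zeta (tensor_coef A B c d) T = zeta c (T \<inter> A) * zeta d (T \<inter> B)"
    by (rule zeta_tensor[OF bc(1) bd(1) disj T])
  \<comment> \<open>If neither side is full, minimum is product on {0, 1}. If only \<open>A\<close>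
    is full, the first entry is 1 unless \<open>outs B d \<subseteq> T\<close>, and then the factor
    \<open>d\<close> is 0 anyway; symmetrically for \<open>B\<close>. If both are full, everything
    is 1.\<close>
  moreover have "inf (if A \<subseteq> T then ?kd else zeta c (T \<inter> A)) (if B \<subseteq> T then ?kc else zeta d (T \<inter> B)) =
      zeta c (T \<inter> A) * zeta d (T \<inter> B)"
    using zc zd zA zB oA oB outs
    by (cases "A \<subseteq> T"; cases "B \<subseteq> T"; cases "outs A c \<subseteq> T"; cases "outs B d \<subseteq> T")
      (auto simp: inf_min)
  ultimately show "eval_expr (map_lattice_expr (\<lambda>g. zeta g T) (Meet (map_lattice_expr (series_coef A B (outs B d)) e)
      (map_lattice_expr (series_coef B A (outs A c)) e'))) = zeta (tensor_coef A B c d) T"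
    using 1 2 by (simp add: lattice_expr.map_comp comp_def)
qed

lemma ex_represents:
  "type_coef A c \<Longrightarrow>
    \<exists>e. represents A c e \<and> card (leaves e) \<le> card {C. subset.maxchain (red c) C}"
proof (induction rule: type_coef.induct)
  case (one a)
  \<comment> \<open>The single leaf is paid for by the existence of at least one maximal
    chain.\<close>
  have "card {C. subset.maxchain (red (single {} :: 'a set \<Rightarrow> real)) C} > 0"
    by (rule card_maxchains_pos) (simp add: red_single)
  moreover have "represents {a} (single {}) (Leaf (single {}))"
    by (simp add: represents_def chain_coef_single)
  ultimately show ?case by (intro exI[of _ "Leaf (single {})"]) simp
next
  case (star A c)
  then obtain e where e: "represents A c e" "card (leaves e) \<le> card {C. subset.maxchain (red c) C}" by blast
  have "card (leaves (map_lattice_expr (star_coef A) (dual_expr e))) \<le> card (leaves e)"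
    by (simp add: lattice_expr.set_map card_image_le finite_leaves)
  then show ?case
    using e(2) card_maxchains_star[OF star.hyps] represents_star[OF star.hyps e(1)]
    by (intro exI[of _ "map_lattice_expr (star_coef A) (dual_expr e)"]) simp
next
  case (tensor A c B d)
  note bc = type_coef_basics[OF tensor.hyps(1)] and bd = type_coef_basics[OF tensor.hyps(2)]
  obtain e where e: "represents A c e" "card (leaves e) \<le> card {C. subset.maxchain (red c) C}"
    using tensor.IH(1) by blast
  obtain e' where e': "represents B d e'" "card (leaves e') \<le> card {C. subset.maxchain (red d) C}"
    using tensor.IH(2) by blast
  have image: "card (leaves (map_lattice_expr h f)) \<le> card (leaves f)"
    for h :: "('a set \<Rightarrow> real) \<Rightarrow> ('a set \<Rightarrow> real)" and f
    by (simp add: lattice_expr.set_map card_image_le finite_leaves)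
  have disj': "B \<inter> A = {}" using tensor.hyps(3) by blast
  consider T where "c = single T" | T where "d = single T" | "\<And>T. c \<noteq> single T" "\<And>T. d \<noteq> single T" by blast
  then show ?case
  proof cases
    case (1 T)
    then have T: "T \<subseteq> A" using bc(3) by (simp add: supp_single)
    show ?thesis
      using represents_tensor_single[OF tensor.hyps(2) e'(1) tensor.hyps(3) T bc(1,2)]
        card_maxchains_tensor_single[OF tensor.hyps(2,3) T] e'(2) image[of _ e'] 1
      by (metis (no_types, lifting) order_trans)
  next
    case (2 T)
    then have T: "T \<subseteq> B" using bd(3) by (simp add: supp_single)
    have "tensor_coef A B c d = tensor_coef B A (single T) c" "A \<union> B = B \<union> A"
      using 2 tensor_coef_commute[of A B] by auto
    then show ?thesis
      using represents_tensor_single[OF tensor.hyps(1) e(1) disj' T bd(1,2)]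
        card_maxchains_tensor_single[OF tensor.hyps(1) disj' T] e(2) image[of _ e]
      by (metis (no_types, lifting) order_trans)
  next
    case 3
    let ?e = "Meet (map_lattice_expr (series_coef A B (outs B d)) e)
      (map_lattice_expr (series_coef B A (outs A c)) e')"
    have "card (leaves ?e) \<le> card (leaves e) + card (leaves e')"
      using card_Un_le[of "leaves (map_lattice_expr (series_coef A B (outs B d)) e)"
          "leaves (map_lattice_expr (series_coef B A (outs A c)) e')"]
        image[of "series_coef A B (outs B d)" e] image[of "series_coef B A (outs A c)" e'] by simp
    then show ?thesis
      using card_maxchains_tensor[OF tensor.hyps 3] e(2) e'(2)
        represents_tensor[OF tensor.hyps(1) e(1) tensor.hyps(2) e'(1) tensor.hyps(3)]
      by (intro exI[of _ ?e]) simp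
  qed
qed

subsection \<open>Boolean functions from coefficients\<close>

definition zeros :: "nat \<Rightarrow> string01 \<Rightarrow> nat set" where
  "zeros n s = {i \<in> {1..n}. s i = 0}"

text \<open>This is the function with p-coefficients \<open>c\<close>, because p_S has value 1
  exactly at the strings whose zeros contain \<open>S\<close>.\<close>

definition boolfun_of :: "nat \<Rightarrow> (nat set \<Rightarrow> real) \<Rightarrow> boolfun" where
  "boolfun_of n c = (\<lambda>s\<in>strings n. zeta c (zeros n s))"

lemma zeros_subset: "zeros n s \<subseteq> {1..n}"
  by (auto simp: zeros_def)

lemma finite_zeros: "finite (zeros n s)"
  by (simp add: zeros_def)

lemma string_eq_indicator: "s \<in> strings n \<Longrightarrow> s = (\<lambda>i\<in>{1..n}. of_bool (i \<notin> zeros n s))"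
proof (rule extensionalityI[of _ "{1..n}"])
  assume s: "s \<in> strings n"
  then show "s \<in> extensional {1..n}" by (simp add: strings_def PiE_def)
  show "s i = (\<lambda>i\<in>{1..n}. of_bool (i \<notin> zeros n s)) i" if "i \<in> {1..n}" for i
    using strings_mem[OF s that] that by (auto simp: zeros_def)
qed simp

lemma zeros_indicator: "T \<subseteq> {1..n} \<Longrightarrow> zeros n (\<lambda>i\<in>{1..n}. of_bool (i \<notin> T)) = T"
  by (auto simp: zeros_def)

lemma indicator_in_strings: "(\<lambda>i\<in>{1..n}. of_bool (i \<notin> T)) \<in> strings n"
  by (rule restrict_in_strings) simp

lemma zeros_eq_full_iff: "s \<in> strings n \<Longrightarrow> zeros n s = {1..n} \<longleftrightarrow> s = zero_string n"
proof
  assume s: "s \<in> strings n" and "zeros n s = {1..n}"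
  then have "s = (\<lambda>i\<in>{1..n}. of_bool (i \<notin> {1..n}))" using string_eq_indicator by metis
  also have "\<dots> = zero_string n" unfolding zero_string_def by (rule restrict_ext) simp
  finally show "s = zero_string n" .
qed (auto simp: zeros_def zero_string_def)

lemma p_fun_eq: "s \<in> strings n \<Longrightarrow> S \<subseteq> {1..n} \<Longrightarrow> p_fun n S s = of_bool (S \<subseteq> zeros n s)"
  using p_fun_indicator[of S n "zeros n s"] string_eq_indicator[of s n] by metis

lemma perm_string_in_strings:
  assumes "\<sigma> permutes {1..n}" "s \<in> strings n"
  shows "perm_string n \<sigma> s \<in> strings n"
  unfolding perm_string_def
proof (rule restrict_in_strings)
  fix i assume "i \<in> {1..n}"
  then have "inv \<sigma> i \<in> {1..n}" using permutes_in_image[OF permutes_inv[OF assms(1)]] by blast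
  then show "s (inv \<sigma> i) \<in> {0, 1}" by (rule strings_mem[OF assms(2)])
qed

lemma zeros_perm_string:
  assumes "\<sigma> permutes {1..n}"
  shows "zeros n (perm_string n \<sigma> s) = \<sigma> ` zeros n s"
proof (intro equalityI subsetI)
  fix i assume "i \<in> zeros n (perm_string n \<sigma> s)"
  then have "i \<in> {1..n}" "s (inv \<sigma> i) = 0" by (auto simp: zeros_def perm_string_def)
  then have "inv \<sigma> i \<in> zeros n s"
    using permutes_in_image[OF permutes_inv[OF assms]] unfolding zeros_def by blast
  then show "i \<in> \<sigma> ` zeros n s" by (rule rev_image_eqI) (simp add: permutes_inverses[OF assms])
next
  fix i assume "i \<in> \<sigma> ` zeros n s"
  then obtain k where k: "k \<in> zeros n s" "i = \<sigma> k" by blast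
  then have "\<sigma> k \<in> {1..n}" using permutes_in_image[OF assms] unfolding zeros_def by blast
  then show "i \<in> zeros n (perm_string n \<sigma> s)"
    using k permutes_inverses(2)[OF assms] by (auto simp: zeros_def perm_string_def)
qed

lemma zeros_append:
  "zeros m (\<lambda>i\<in>{1..m}. s i) = zeros (m + n) s \<inter> {1..m}"
  "(+) m ` zeros n (\<lambda>i\<in>{1..n}. s (m + i)) = zeros (m + n) s \<inter> (+) m ` {1..n}"
proof -
  show "zeros m (\<lambda>i\<in>{1..m}. s i) = zeros (m + n) s \<inter> {1..m}" by (auto simp: zeros_def)
  have "zeros n (\<lambda>i\<in>{1..n}. s (m + i)) = {i \<in> {1..n}. s (m + i) = 0}" by (auto simp: zeros_def)
  moreover have "m + i \<in> {1..m + n}" if "i \<in> {1..n}" for i using that by simp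
  ultimately show "(+) m ` zeros n (\<lambda>i\<in>{1..n}. s (m + i)) = zeros (m + n) s \<inter> (+) m ` {1..n}"
    unfolding zeros_def[of "m + n"] by blast
qed

lemma atLeastAtMost_append: "{1..m} \<union> (+) m ` {1..n} = {1..m + n :: nat}"
  by (auto simp: image_add_atLeastAtMost)

lemma split_in_strings:
  assumes "s \<in> strings (m + n)"
  shows "(\<lambda>i\<in>{1..m}. s i) \<in> strings m" "(\<lambda>i\<in>{1..n}. s (m + i)) \<in> strings n"
  by (intro restrict_in_strings strings_mem[OF assms]; simp)+

text \<open>The construction of \<open>c\<close> can be repeated on the relabelled sets: injectivity
  preserves disjointness for the tensor rule and equality with the full set for star. It serves for
  permutations and for the shift in a concatenation.\<close>

lemma type_coef_relabel:
  assumes "type_coef A c" "inj_on \<pi> A"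
  shows "\<exists>c'. type_coef (\<pi> ` A) c' \<and> (\<forall>T\<subseteq>A. zeta c' (\<pi> ` T) = zeta c T)"
  using assms
proof induction
  case (one a)
  have "zeta (single {}) (\<pi> ` T) = zeta (single {}) T" if "T \<subseteq> {a}" for T
    using finite_subset[OF that] by (simp add: zeta_single)
  moreover have "type_coef (\<pi> ` {a}) (single {})" using type_coef.one by simp
  ultimately show ?case by blast
next
  case (star A c)
  then obtain c' where c': "type_coef (\<pi> ` A) c'" "\<forall>T\<subseteq>A. zeta c' (\<pi> ` T) = zeta c T" by blast
  have "zeta (star_coef (\<pi> ` A) c') (\<pi> ` T) = zeta (star_coef A c) T" if "T \<subseteq> A" for T
    using that c'(2) type_coef_basics(1)[OF star.hyps] inj_on_image_eq_iff[OF star.prems that order_refl]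
    by (simp add: zeta_star image_mono)
  then show ?case using type_coef.star[OF c'(1)] by blast
next
  case (tensor A c B d)
  have inj: "inj_on \<pi> A" "inj_on \<pi> B" using tensor.prems by (auto simp: inj_on_Un)
  obtain c' where c': "type_coef (\<pi> ` A) c'" "\<forall>T\<subseteq>A. zeta c' (\<pi> ` T) = zeta c T"
    using tensor.IH(1)[OF inj(1)] by blast
  obtain d' where d': "type_coef (\<pi> ` B) d'" "\<forall>T\<subseteq>B. zeta d' (\<pi> ` T) = zeta d T"
    using tensor.IH(2)[OF inj(2)] by blast
  have disj: "\<pi> ` A \<inter> \<pi> ` B = {}"
    using inj_on_image_Int[OF tensor.prems, of A B] tensor.hyps(3) by auto
  have "zeta (tensor_coef (\<pi> ` A) (\<pi> ` B) c' d') (\<pi> ` T) = zeta (tensor_coef A B c d) T"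
    if "T \<subseteq> A \<union> B" for T
  proof -
    have "\<pi> ` T \<inter> \<pi> ` A = \<pi> ` (T \<inter> A)" "\<pi> ` T \<inter> \<pi> ` B = \<pi> ` (T \<inter> B)"
      using inj_on_image_Int[OF tensor.prems that, of A] inj_on_image_Int[OF tensor.prems that, of B] by auto
    moreover have "\<pi> ` T \<subseteq> \<pi> ` A \<union> \<pi> ` B" using that by blast
    ultimately show ?thesis
      using c'(2) d'(2)
        zeta_tensor[OF type_coef_basics(1)[OF c'(1)] type_coef_basics(1)[OF d'(1)] disj]
        zeta_tensor[OF type_coef_basics(1)[OF tensor.hyps(1)] type_coef_basics(1)[OF tensor.hyps(2)] tensor.hyps(3) that]
      by simp
  qed
  then show ?case using type_coef.tensor[OF c'(1) d'(1) disj] by (metis image_Un)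
qed

lemma type_coef_of_is_type:
  assumes "is_type n f"
  shows "\<exists>c. type_coef {1..n} c \<and> (\<forall>s\<in>strings n. f s = zeta c (zeros n s))"
  using assms
proof induction
  case one
  have "type_coef {1..1} (single {} :: nat set \<Rightarrow> real)" using type_coef.one[of "1::nat"] by simp
  then show ?case by (intro exI[of _ "single {}"]) (simp add: zeta_single finite_zeros)
next
  case (compl n f)
  then obtain c where c: "type_coef {1..n} c" "\<forall>s\<in>strings n. f s = zeta c (zeros n s)" by blast
  then have "\<forall>s\<in>strings n. compl_fun n f s = zeta (star_coef {1..n} c) (zeros n s)"
    by (simp add: compl_fun_def zeta_star zeros_subset zeros_eq_full_iff del: One_nat_def)
  then show ?case using type_coef.star[OF c(1)] by blast
next
  case (perm n f \<sigma>)
  then obtain c where c: "type_coef {1..n} c" "\<forall>s\<in>strings n. f s = zeta c (zeros n s)" by blast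
  have inv: "inv \<sigma> permutes {1..n}" by (rule permutes_inv[OF perm.hyps(2)])
  \<comment> \<open>Permuting a string moves its zeros by \<open>\<sigma>\<close>, so the labels are
    moved back by the inverse.\<close>
  obtain c' where c': "type_coef (inv \<sigma> ` {1..n}) c'"
    "\<forall>T\<subseteq>{1..n}. zeta c' (inv \<sigma> ` T) = zeta c T"
    using type_coef_relabel[OF c(1) inj_on_subset[OF permutes_inj[OF inv] subset_UNIV]] by blast
  have "perm_fun n f \<sigma> s = zeta c' (zeros n s)" if s: "s \<in> strings n" for s
  proof -
    have "perm_fun n f \<sigma> s = zeta c (\<sigma> ` zeros n s)"
      using s c(2) perm_string_in_strings[OF perm.hyps(2) s] zeros_perm_string[OF perm.hyps(2)]
      by (simp add: perm_fun_def)
    also have "\<dots> = zeta c' (inv \<sigma> ` \<sigma> ` zeros n s)"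
      using c'(2) image_mono[OF zeros_subset[of n s], of \<sigma>] permutes_image[OF perm.hyps(2)] by simp
    also have "inv \<sigma> ` \<sigma> ` zeros n s = zeros n s"
      by (simp add: image_image permutes_inverses(2)[OF perm.hyps(2)])
    finally show ?thesis .
  qed
  then show ?case using c'(1) permutes_image[OF inv] by auto
next
  case (tensor m f n g)
  obtain c where c: "type_coef {1..m} c" "\<forall>s\<in>strings m. f s = zeta c (zeros m s)"
    using tensor.IH(1) by blast
  obtain d where d: "type_coef {1..n} d" "\<forall>s\<in>strings n. g s = zeta d (zeros n s)"
    using tensor.IH(2) by blast
  \<comment> \<open>The labels of the second factor are shifted to the last \<open>n\<close>
    positions, disjoint from those of the first.\<close>
  obtain d' where d': "type_coef ((+) m ` {1..n}) d'" "\<forall>T\<subseteq>{1..n}. zeta d' ((+) m ` T) = zeta d T"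
    using type_coef_relabel[OF d(1), of "(+) m"] by auto
  have disj: "{1..m} \<inter> (+) m ` {1..n} = {}" by auto
  note un = atLeastAtMost_append[of m n]
  have "tensor_fun m n f g s = zeta (tensor_coef {1..m} ((+) m ` {1..n}) c d') (zeros (m + n) s)"
    if s: "s \<in> strings (m + n)" for s
  proof -
    have "zeros (m + n) s \<subseteq> {1..m} \<union> (+) m ` {1..n}" unfolding un by (rule zeros_subset)
    then have "zeta (tensor_coef {1..m} ((+) m ` {1..n}) c d') (zeros (m + n) s) =
        zeta c (zeros (m + n) s \<inter> {1..m}) * zeta d' (zeros (m + n) s \<inter> (+) m ` {1..n})"
      by (intro zeta_tensor disj) auto
    also have "\<dots> = zeta c (zeros m (\<lambda>i\<in>{1..m}. s i)) * zeta d (zeros n (\<lambda>i\<in>{1..n}. s (m + i)))"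
      using d'(2) zeros_subset[of n "\<lambda>i\<in>{1..n}. s (m + i)"]
      unfolding zeros_append(1)[of m s n, symmetric] zeros_append(2)[symmetric] by simp
    also have "\<dots> = f (\<lambda>i\<in>{1..m}. s i) * g (\<lambda>i\<in>{1..n}. s (m + i))"
      using c(2) d(2) split_in_strings[OF s] by simp
    finally show ?thesis using s by (simp add: tensor_fun_def)
  qed
  then show ?case using type_coef.tensor[OF c(1) d'(1) disj] unfolding un by blast
qed

text \<open>The label sets of the factors need not be intervals, so the induction ranges over all
  enumerations \<open>\<pi>\<close> of \<open>A\<close>.\<close>

lemma is_type_of_type_coef:
  assumes "type_coef A c" "bij_betw \<pi> {1..n} A"
  shows "is_type n (\<lambda>s\<in>strings n. zeta c (\<pi> ` zeros n s))"
  using assms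
proof (induction arbitrary: n \<pi>)
  case (one a)
  then have n: "n = 1" using bij_betw_same_card by fastforce
  have "(\<lambda>s\<in>strings n. zeta (single {}) (\<pi> ` zeros n s)) = (\<lambda>s\<in>strings 1. 1)"
    unfolding n by (rule restrict_ext) (simp add: zeta_single finite_zeros)
  then show ?case using is_type.one n by (simp only:)
next
  case (star A c)
  have "(\<lambda>s\<in>strings n. zeta (star_coef A c) (\<pi> ` zeros n s)) =
      compl_fun n (\<lambda>s\<in>strings n. zeta c (\<pi> ` zeros n s))"
    unfolding compl_fun_def
  proof (rule restrict_ext)
    fix s assume s: "s \<in> strings n"
    have "A = \<pi> ` {1..n}" "inj_on \<pi> {1..n}" using star.prems by (auto simp: bij_betw_def)
    then have "\<pi> ` zeros n s = A \<longleftrightarrow> s = zero_string n"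
      using inj_on_image_eq_iff[of \<pi> "{1..n}" "zeros n s" "{1..n}"] zeros_subset zeros_eq_full_iff[OF s] by simp
    moreover have "\<pi> ` zeros n s \<subseteq> A" using zeros_subset \<open>A = _\<close> by blast
    ultimately show "zeta (star_coef A c) (\<pi> ` zeros n s) =
        1 - (\<lambda>s\<in>strings n. zeta c (\<pi> ` zeros n s)) s + of_bool (s = zero_string n)"
      using s type_coef_basics(1)[OF star.hyps] by (simp add: zeta_star)
  qed
  then show ?case using is_type.compl[OF star.IH[OF star.prems]] by (simp only:)
next
  case (tensor A c B d)
  note finA = type_coef_basics(1)[OF tensor.hyps(1)] and finB = type_coef_basics(1)[OF tensor.hyps(2)]
  define m k where "m = card A" and "k = card B"
  have n: "n = m + k"
    using bij_betw_same_card[OF tensor.prems] card_Un_disjoint[OF finA finB tensor.hyps(3)]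
    by (simp add: m_def k_def)
  obtain \<alpha> where \<alpha>: "bij_betw \<alpha> {1..m} A" using ex_bij_betw_nat_finite_1[OF finA] m_def by blast
  obtain \<beta> where \<beta>: "bij_betw \<beta> {1..k} B" using ex_bij_betw_nat_finite_1[OF finB] k_def by blast
  \<comment> \<open>\<open>\<gamma>\<close> enumerates first \<open>A\<close> and then
    \<open>B\<close>, as concatenation does, whereas the given \<open>\<pi>\<close> may interleave
    them.\<close>
  define \<gamma> where "\<gamma> i = (if i \<in> {1..m} then \<alpha> i else \<beta> (i - m))" for i
  have \<gamma>1: "\<gamma> ` U = \<alpha> ` U" if "U \<subseteq> {1..m}" for U using that unfolding \<gamma>_def by (intro image_cong) auto
  have \<gamma>2: "\<gamma> ` (+) m ` U = \<beta> ` U" if "U \<subseteq> {1..k}" for U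
    unfolding image_image using that by (intro image_cong) (auto simp: \<gamma>_def)
  have un: "{1..m} \<union> (+) m ` {1..k} = {1..n}"
    unfolding n by (rule atLeastAtMost_append)
  have img: "\<alpha> ` {1..m} = A" "\<beta> ` {1..k} = B" using \<alpha> \<beta> by (auto simp: bij_betw_def)
  have surj: "\<gamma> ` {1..n} = A \<union> B" unfolding un[symmetric] image_Un \<gamma>1[OF order_refl] \<gamma>2[OF order_refl] img ..
  have \<gamma>: "bij_betw \<gamma> {1..n} (A \<union> B)"
    unfolding bij_betw_def
  proof
    have "card (A \<union> B) = n" using card_Un_disjoint[OF finA finB tensor.hyps(3)] n m_def k_def by simp
    then show "inj_on \<gamma> {1..n}" by (intro eq_card_imp_inj_on) (simp_all add: surj del: One_nat_def)
  qed (rule surj)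
  let ?h = "tensor_coef A B c d"
  let ?F = "tensor_fun m k (\<lambda>s\<in>strings m. zeta c (\<alpha> ` zeros m s)) (\<lambda>s\<in>strings k. zeta d (\<beta> ` zeros k s))"
  have F: "?F s = zeta ?h (\<gamma> ` zeros n s)" if s: "s \<in> strings n" for s
  proof -
    have sub: "\<gamma> ` zeros n s \<subseteq> A \<union> B" using surj zeros_subset[of n s] by blast
    have z: "zeros n s = (zeros n s \<inter> {1..m}) \<union> (zeros n s \<inter> (+) m ` {1..k})"
      using zeros_subset[of n s] un by blast
    have a: "\<gamma> ` (zeros n s \<inter> {1..m}) = \<alpha> ` zeros m (\<lambda>i\<in>{1..m}. s i)"
      unfolding n zeros_append(1)[of m s k, symmetric] by (rule \<gamma>1[OF zeros_subset])
    have b: "\<gamma> ` (zeros n s \<inter> (+) m ` {1..k}) = \<beta> ` zeros k (\<lambda>i\<in>{1..k}. s (m + i))"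
      unfolding n zeros_append(2)[symmetric] by (rule \<gamma>2[OF zeros_subset])
    have ab: "\<alpha> ` zeros m (\<lambda>i\<in>{1..m}. s i) \<subseteq> A" "\<beta> ` zeros k (\<lambda>i\<in>{1..k}. s (m + i)) \<subseteq> B"
      using img zeros_subset by blast+
    have "\<gamma> ` zeros n s = \<alpha> ` zeros m (\<lambda>i\<in>{1..m}. s i) \<union> \<beta> ` zeros k (\<lambda>i\<in>{1..k}. s (m + i))"
      by (subst z) (simp only: image_Un a b)
    then have "\<gamma> ` zeros n s \<inter> A = \<alpha> ` zeros m (\<lambda>i\<in>{1..m}. s i)"
      "\<gamma> ` zeros n s \<inter> B = \<beta> ` zeros k (\<lambda>i\<in>{1..k}. s (m + i))"
      using ab tensor.hyps(3) by blast+
    then have "zeta ?h (\<gamma> ` zeros n s) = zeta c (\<alpha> ` zeros m (\<lambda>i\<in>{1..m}. s i)) *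
        zeta d (\<beta> ` zeros k (\<lambda>i\<in>{1..k}. s (m + i)))"
      using zeta_tensor[OF finA finB tensor.hyps(3) sub] by simp
    then show ?thesis
      using s split_in_strings[of s m k] by (simp add: tensor_fun_def n)
  qed
  \<comment> \<open>This permutation of positions turns \<open>\<gamma>\<close> into
    \<open>\<pi>\<close>; it is the identity outside \<open>{1..n}\<close>, as
    \<open>permutes\<close> demands.\<close>
  define \<sigma> where "\<sigma> i = (if i \<in> {1..n} then inv_into {1..n} \<gamma> (\<pi> i) else i)" for i
  have "bij_betw (inv_into {1..n} \<gamma> \<circ> \<pi>) {1..n} {1..n}"
    using bij_betw_trans[OF tensor.prems bij_betw_inv_into[OF \<gamma>]] .
  then have "bij_betw \<sigma> {1..n} {1..n}" by (rule bij_betw_cong[THEN iffD1, rotated]) (simp add: \<sigma>_def)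
  then have \<sigma>: "\<sigma> permutes {1..n}" by (rule bij_imp_permutes) (auto simp: \<sigma>_def)
  have \<gamma>\<sigma>: "\<gamma> ` \<sigma> ` zeros n s = \<pi> ` zeros n s" for s
  proof -
    have "\<gamma> (\<sigma> i) = \<pi> i" if "i \<in> {1..n}" for i
    proof -
      have "\<pi> i \<in> \<gamma> ` {1..n}" using that tensor.prems \<gamma> by (auto simp: bij_betw_def)
      then show ?thesis using that f_inv_into_f[of "\<pi> i" \<gamma> "{1..n}"] by (simp add: \<sigma>_def)
    qed
    then show ?thesis unfolding image_image using zeros_subset[of n s] by (intro image_cong) auto
  qed
  have "perm_fun n ?F \<sigma> = (\<lambda>s\<in>strings n. zeta ?h (\<pi> ` zeros n s))"
    unfolding perm_fun_def
  proof (rule restrict_ext)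
    fix s assume s: "s \<in> strings n"
    show "?F (perm_string n \<sigma> s) = zeta ?h (\<pi> ` zeros n s)"
      using F[OF perm_string_in_strings[OF \<sigma> s]] \<gamma>\<sigma> by (simp add: zeros_perm_string[OF \<sigma>])
  qed
  moreover have "is_type n ?F"
    unfolding n by (intro is_type.tensor tensor.IH \<alpha> \<beta>)
  ultimately show ?case using is_type.perm[OF _ \<sigma>] by metis
qed

section \<open>Outputs, reduced posets and chain types of the resulting Boolean functions\<close>

lemma is_type_boolfun_of: "type_coef {1..n} c \<Longrightarrow> boolfun_of n c \<in> type_functions n"
  using is_type_of_type_coef[of "{1..n}" c id n] by (simp add: boolfun_of_def type_functions_def)

lemma outputs_boolfun_of: "outputs n (boolfun_of n c) = outs {1..n} c"
proof -
  have "unit_string n j \<in> strings n" for j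
    unfolding unit_string_def by (rule restrict_in_strings) simp
  moreover have "zeros n (unit_string n j) = {1..n} - {j}" for j
    by (auto simp: zeros_def unit_string_def)
  ultimately show ?thesis by (simp add: outputs_def outs_def boolfun_of_def)
qed

text \<open>By uniqueness of the expansion it suffices that \<open>c\<close> is one; the restriction
  makes it extensional, as \<open>p_expansion\<close> requires.\<close>

lemma coefs_boolfun_of: "coefs n (boolfun_of n c) = (\<lambda>T\<in>Pow {1..n}. c T)"
proof -
  have ext: "boolfun_of n c \<in> extensional (strings n)"
    unfolding boolfun_of_def by (rule restrict_extensional)
  have "boolfun_of n c (\<lambda>i\<in>{1..n}. of_bool (i \<notin> T)) = (\<Sum>S\<in>Pow T. (\<lambda>T\<in>Pow {1..n}. c T) S)"
    if T: "T \<subseteq> {1..n}" for T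
  proof -
    have "boolfun_of n c (\<lambda>i\<in>{1..n}. of_bool (i \<notin> T)) = zeta c T"
      unfolding boolfun_of_def restrict_apply'[OF indicator_in_strings] zeros_indicator[OF T] ..
    also have "\<dots> = (\<Sum>S\<in>Pow T. (\<lambda>T\<in>Pow {1..n}. c T) S)"
      unfolding zeta_def using T by (intro sum.cong) auto
    finally show ?thesis .
  qed
  then have "p_expansion n (boolfun_of n c) (\<lambda>T\<in>Pow {1..n}. c T)"
    unfolding p_expansion_iff[OF ext] by (intro conjI allI impI restrict_extensional)
  then show ?thesis using p_expansion_coefs[OF ext] ex1_p_expansion[OF ext] by blast
qed

lemma reduced_poset_boolfun_of:
  assumes "supp c \<subseteq> Pow {1..n}"
  shows "reduced_poset n (boolfun_of n c) = red c"
proof -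
  have "structure_poset n (boolfun_of n c) = supp c"
    using assms by (auto simp: structure_poset_def coefs_boolfun_of supp_def)
  then show ?thesis by (simp add: reduced_poset_def red_def new_labels_def new_at_def)
qed

lemma zeta_alt: "finite T \<Longrightarrow> zeta (alt L) T = (\<Sum>i<length L. (-1) ^ i * of_bool (L ! i \<subseteq> T))"
proof (induction L)
  case Nil
  then show ?case by (simp add: zeta_def)
next
  case (Cons S L)
  then show ?case
    by (simp add: zeta_diff zeta_single sum.lessThan_Suc_shift sum_negf del: sum.lessThan_Suc)
qed

lemma chain_type_boolfun_of:
  assumes c: "chain_coef {1..n} False c" and "n \<noteq> 0"
  shows "chain_type n (boolfun_of n c)"
proof -
  obtain L where L: "sorted_wrt (\<subset>) L" "set L \<subseteq> Pow {1..n}" "odd (length L)" "c = alt L"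
    using c unfolding chain_coef_def by auto
  \<comment> \<open>\<open>N\<close> is the index of the last member, so odd length becomes even
    \<open>N\<close>.\<close>
  define N where "N = length L - 1"
  have len: "length L = Suc N" using L(3) by (cases L) (auto simp: N_def)
  have sub: "L ! i \<subseteq> {1..n}" if "i \<le> N" for i
  proof -
    have "L ! i \<in> set L" using len that by simp
    then show ?thesis using L(2) by blast
  qed
  have "boolfun_of n c = (\<lambda>s\<in>strings n. \<Sum>i\<le>N. (-1) ^ i * p_fun n (L ! i) s)"
    unfolding boolfun_of_def
  proof (rule restrict_ext)
    fix s assume s: "s \<in> strings n"
    have "zeta c (zeros n s) = (\<Sum>i\<le>N. (-1) ^ i * of_bool (L ! i \<subseteq> zeros n s))"
      by (simp add: L(4) zeta_alt[OF finite_zeros] len lessThan_Suc_atMost)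
    also have "\<dots> = (\<Sum>i\<le>N. (-1) ^ i * p_fun n (L ! i) s)"
      using s sub by (intro sum.cong) (auto simp: p_fun_eq)
    finally show "zeta c (zeros n s) = (\<Sum>i\<le>N. (-1) ^ i * p_fun n (L ! i) s)" .
  qed
  moreover have "even N" using L(3) len by simp
  moreover have "L ! i \<subset> L ! Suc i" if "i < N" for i
    using sorted_wrt_nth_less[OF L(1), of i "Suc i"] that len by simp
  moreover have "boolfun_of n c \<in> type_functions n"
    using assms by (intro is_type_boolfun_of type_coef_chain) auto
  ultimately show ?thesis unfolding chain_type_def using sub[of N] by blast
qed

lemma eval_expr_apply:
  fixes e :: "('a \<Rightarrow> 'b::lattice) lattice_expr"
  shows "eval_expr e x = eval_expr (map_lattice_expr (\<lambda>g. g x) e)"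
  by (induction e) auto

theorem proposition5p7:
  fixes n :: nat and f :: boolfun
  assumes "f \<in> type_functions n"
  shows "\<exists>e. normal_form n f e \<and>
           card (leaves e) \<le> card {C. subset.maxchain (reduced_poset n f) C}"
proof -
  obtain c where c: "type_coef {1..n} c" "\<forall>s\<in>strings n. f s = zeta c (zeros n s)"
    using type_coef_of_is_type[of n f] assms by (auto simp: type_functions_def)
  note b = type_coef_basics[OF c(1)]
  have "f \<in> extensional (strings n)" using assms type_functions_subset[of n] by (auto simp: bool_functions_iff)
  then have f: "f = boolfun_of n c"
    using c(2) by (intro extensionalityI[of f "strings n"]) (simp_all add: boolfun_of_def)
  obtain e where e: "represents {1..n} c e" "card (leaves e) \<le> card {C. subset.maxchain (red c) C}"
    using ex_represents[OF c(1)] by blast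
  note r = representsD[OF e(1)]
  let ?e = "map_lattice_expr (boolfun_of n) e"
  have "eval_expr ?e = f"
  proof
    fix s
    have "eval_expr ?e s = eval_expr (map_lattice_expr (\<lambda>g. boolfun_of n g s) e)"
      by (simp add: eval_expr_apply[of ?e] lattice_expr.map_comp comp_def)
    also have "\<dots> = f s"
    proof (cases "s \<in> strings n")
      case True
      then show ?thesis using r(3)[OF zeros_subset[of n s]] by (simp add: f boolfun_of_def)
    next
      case False
      \<comment> \<open>Outside the strings every leaf is \<open>undefined\<close>, and idempotence
        of the lattice operations keeps this value.\<close>
      then show ?thesis by (subst eval_expr_const[of _ _ undefined]) (simp_all add: f boolfun_of_def)
    qed
    finally show "eval_expr ?e s = f s" .
  qed
  moreover have "chain_type n g \<and> g \<in> type_functions_out n (outputs n f)" if g: "g \<in> leaves ?e" for g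
  proof -
    obtain h where h: "h \<in> leaves e" "g = boolfun_of n h" using g by (auto simp: lattice_expr.set_map)
    have "chain_type n g" using chain_type_boolfun_of[OF r(1)[OF h(1)]] b(2) h(2) by auto
    moreover from this have "g \<in> type_functions n" by (simp add: chain_type_def)
    moreover have "outputs n g = outputs n f" using r(2)[OF h(1)] h(2) f by (simp add: outputs_boolfun_of)
    ultimately show ?thesis by (simp add: type_functions_out_def)
  qed
  moreover have "card (leaves ?e) \<le> card (leaves e)"
    by (simp add: lattice_expr.set_map card_image_le finite_leaves)
  ultimately show ?thesis
    using e(2) reduced_poset_boolfun_of[OF b(3)] f
    by (intro exI[of _ ?e]) (simp add: normal_form_def)
qed

end
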